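(* Let $r>0$. For all $x\ge0$, $A\in[0,2]$ and $\lambda>0$, $$\mathbb{B}_r(x,A,\lambda)=\mathbb{M}_r\big(x\lambda^{-1/r},\,A\big),$$ where $\mathbb{B}_r$ is the Bellman function and $\mathbb{M}_r:[0,\infty)\times[0,2]\to[0,1]$ is the explicit piecewise linear function, both defined in the context.
   Context: Dyadic lattice: fix a bounded nonempty interval $I=[a,b)$. For $J=[c,d)$ let $J_-$ and $J_+$ be its left and right halves (half-open). Define $\mathcal{D}_0(I)=\{I\}$, $\mathcal{D}_{k+1}(I)=\{J_-,J_+: J\in\mathcal{D}_k(I)\}$ and $\mathcal{D}(I)=\bigcup_{k\ge 0}\mathcal{D}_k(I)$. Write $|E|$ for Lebesgue measure and $\langle f\rangle_J=\frac1{|J|}\int_J f(t)\,dt$. A binary sequence adapted to $I$ is a family $\alpha=\{\alpha_J\}_{J\in\mathcal{D}(I)}$ with $\alpha_J\in\{0,1\}$. For $J\in\mathcal{D}(I)$ put $A(\alpha;J)=\frac1{|J|}\sum_{K\in\mathcal{D}(J)}\alpha_K|K|$. The set $\mathfrak{S}_2(I)$ consists of all such $\alpha$ with $\sup_{J\in\mathcal{D}(I)}A(\alpha;J)\le 2$. Bellman function: for $x\ge0$, $A\in[0,2]$, $\lambda\in\mathbb{R}$, $$\mathbb{B}_r(x,A,\lambda)=\sup_{f,\alpha}\frac1{|I|}\Big|\Big\{t\in I:\ \sum_{J\in\mathcal{D}(I)}\alpha_J\,\langle f\rangle_J^r\,\mathbf{1}_J(t)\ge\lambda\Big\}\Big|,$$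 the supremum being over all non-negative $f\in L^1(I)$ with $\langle f\rangle_I=x$ and all $\alpha\in\mathfrak{S}_2(I)$ with $A(\alpha;I)=A$. (The value does not depend on the choice of $I$.) Explicit function: for $n\ge0$ let $$\omega_n=\omega_n(r)=\left(\frac{2^r-1}{2^{nr}(2^{r+1}-1)-1}\right)^{1/r},$$ a decreasing sequence with $\omega_0=2^{-1/r}$. Define $\mathfrak{f}_r$ on $[0,\omega_0)$ by $\mathfrak{f}_r(0)=0$ and by linear interpolation between the points $(\omega_n,2^{-n})$, $n\ge0$, i.e. $$\mathfrak{f}_r(\omega)=\frac1{2^n}\left(1+\frac{\omega-\omega_n}{\omega_{n-1}-\omega_n}\right)\quad\text{for }\omega_n\le\omega<\omega_{n-1},\ n\ge1.$$ Consider the following regions covering $[0,\infty)\times[0,2]$: - $\Sigma_0=\{(\omega,A):\max(1,\,1+\frac{1-\omega}{1-\omega_0})\le A\le2\}$, - $\Sigma_1=\{(\omega,A):0\le A<\min(1,\omega)\}$, - $\Delta_0=\{(\omega,A):\omega\le A\le\min(\frac{2\omega}{\omega_0},\,1+\frac{1-\omega}{1-\omega_0})\}$, - $\Delta=\{(\omega,A):\frac{2\omega}{\omega_0}<A\le2\}$ (with $\omega\ge0$ throughout). Then $$\mathbb{M}_r(\omega,A)=\begin{cases}1,&(\omega,A)\in\Sigma_0,\\ A,&(\omega,A)\in\Sigma_1,\\ \dfrac{\omega+(1-\omega_0)A}{2-\omega_0},&(\omega,A)\in\Delta_0,\\ \dfrac A2\,\mathfrak{f}_r\!\left(\dfrac{2\omega}{A}\right),&(\omega,A)\in\Delta.\end{cases}$$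 (The formulas agree where regions overlap.) *)

theory Defs
  imports "HOL-Analysis.Analysis"
begin

section \<open>Dyadic lattice\<close>

text \<open>
  Intervals are sets of reals. The two halves are only ever applied to nonempty bounded
  half-open intervals, where \<open>Inf\<close> and \<open>Sup\<close> are the endpoints.
\<close>

definition left_half :: "real set \<Rightarrow> real set" where
  "left_half J = {Inf J ..< (Inf J + Sup J) / 2}"

definition right_half :: "real set \<Rightarrow> real set" where
  "right_half J = {(Inf J + Sup J) / 2 ..< Sup J}"

lemma left_half_atLeastLessThan: "c < d \<Longrightarrow> left_half {c..<d} = {c ..< (c + d) / 2}"
  by (simp add: left_half_def)

lemma right_half_atLeastLessThan: "c < d \<Longrightarrow> right_half {c..<d} = {(c + d) / 2 ..< d}"
  by (simp add: right_half_def)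

primrec dyadic_level :: "real set \<Rightarrow> nat \<Rightarrow> real set set" where
  "dyadic_level I 0 = {I}"
| "dyadic_level I (Suc k) = (\<Union>J\<in>dyadic_level I k. {left_half J, right_half J})"

definition dyadic :: "real set \<Rightarrow> real set set" where
  "dyadic I = (\<Union>k. dyadic_level I k)"

definition avg :: "(real \<Rightarrow> real) \<Rightarrow> real set \<Rightarrow> real" where
  "avg f J = (LINT t:J|lebesgue. f t) / measure lebesgue J"


section \<open>Binary Carleson sequences\<close>

text \<open>
  Sums over the dyadic lattice are taken in \<^typ>\<open>ennreal\<close>, so that a divergent sum has the
  value \<open>\<infinity>\<close> (in \<^typ>\<open>real\<close> it would silently be \<open>0\<close>). A family indexed by \<open>dyadic I\<close> is a
  total function whose values elsewhere are never used.
\<close>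

definition carleson_avg :: "(real set \<Rightarrow> real) \<Rightarrow> real set \<Rightarrow> ennreal" where
  "carleson_avg \<alpha> J =
     (\<Sum>\<^sub>\<infinity>K\<in>dyadic J. ennreal (\<alpha> K * measure lebesgue K)) / ennreal (measure lebesgue J)"

definition binary_carleson :: "real set \<Rightarrow> (real set \<Rightarrow> real) set" where
  "binary_carleson I =
     {\<alpha>. (\<forall>J\<in>dyadic I. \<alpha> J \<in> {0, 1}) \<and> (SUP J\<in>dyadic I. carleson_avg \<alpha> J) \<le> 2}"


section \<open>The Bellman function\<close>

definition dyadic_operator ::
    "real set \<Rightarrow> real \<Rightarrow> (real set \<Rightarrow> real) \<Rightarrow> (real \<Rightarrow> real) \<Rightarrow> real \<Rightarrow> ennreal" where
  "dyadic_operator I r \<alpha> f t =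
     (\<Sum>\<^sub>\<infinity>J\<in>dyadic I. ennreal (\<alpha> J * avg f J powr r * indicator J t))"

text \<open>
  The supremum is over a set of reals in \<open>{0..1}\<close>. Since \<open>ennreal lam = 0\<close> for \<open>lam \<le> 0\<close>
  and the operator is non-negative, the comparison with \<open>ennreal lam\<close> is correct for every
  real \<open>lam\<close>.
\<close>

definition bellman :: "real set \<Rightarrow> real \<Rightarrow> real \<Rightarrow> real \<Rightarrow> real \<Rightarrow> real" where
  "bellman I r x A lam =
     Sup {measure lebesgue {t \<in> I. dyadic_operator I r \<alpha> f t \<ge> ennreal lam} / measure lebesgue I
          | f \<alpha>. set_integrable lebesgue I f \<and> (\<forall>t\<in>I. 0 \<le> f t) \<and> avg f I = x \<and>
                 \<alpha> \<in> binary_carleson I \<and> carleson_avg \<alpha> I = ennreal A}"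


section \<open>The explicit function\<close>

definition omega :: "real \<Rightarrow> nat \<Rightarrow> real" where
  "omega r n =
     ((2 powr r - 1) / (2 powr (real n * r) * (2 powr (r + 1) - 1) - 1)) powr (1 / r)"

text \<open>
  Meaningful on \<open>{0..<omega r 0}\<close>: for \<open>0 < w < omega r 0\<close> exactly one \<open>n\<close> qualifies, because
  \<open>omega r\<close> decreases strictly to \<open>0\<close>.
\<close>

definition frak_f :: "real \<Rightarrow> real \<Rightarrow> real" where
  "frak_f r w =
     (if w = 0 then 0
      else let n = (THE n. n \<ge> 1 \<and> omega r n \<le> w \<and> w < omega r (n - 1))
           in 1 / 2 ^ n * (1 + (w - omega r n) / (omega r (n - 1) - omega r n)))"

definition Sigma0 :: "real \<Rightarrow> (real \<times> real) set" where
  "Sigma0 r = {(w, A). 0 \<le> w \<and> max 1 (1 + (1 - w) / (1 - omega r 0)) \<le> A \<and> A \<le> 2}"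

definition Sigma1 :: "(real \<times> real) set" where
  "Sigma1 = {(w, A). 0 \<le> w \<and> 0 \<le> A \<and> A < min 1 w}"

definition Delta0 :: "real \<Rightarrow> (real \<times> real) set" where
  "Delta0 r = {(w, A). 0 \<le> w \<and> w \<le> A \<and>
     A \<le> min (2 * w / omega r 0) (1 + (1 - w) / (1 - omega r 0))}"

definition Delta :: "real \<Rightarrow> (real \<times> real) set" where
  "Delta r = {(w, A). 0 \<le> w \<and> 2 * w / omega r 0 < A \<and> A \<le> 2}"

text \<open>
  The four regions cover \<open>{0..} \<times> {0..2}\<close>; the only overlap is between \<open>Sigma0\<close> and \<open>Delta0\<close>,
  along their common edge, where the two formulas agree. So the order of the cases is immaterial.
\<close>

definition explicit_M :: "real \<Rightarrow> real \<Rightarrow> real \<Rightarrow> real" where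
  "explicit_M r w A =
     (if (w, A) \<in> Sigma0 r then 1
      else if (w, A) \<in> Sigma1 then A
      else if (w, A) \<in> Delta0 r then (w + (1 - omega r 0) * A) / (2 - omega r 0)
      else if (w, A) \<in> Delta r then A / 2 * frak_f r (2 * w / A)
      else undefined)"

end

theory Submission
  imports Defs
begin

text \<open>
  Let \<open>B(x, A, \<lambda>)\<close> be the Bellman function. Splitting \<open>I\<close> into its halves shows that
  \<open>B(x, A, \<lambda>)\<close> is an iterated optimum of two moves: a split
  \<open>(x, A) = ((x\<^sub>1, A\<^sub>1) + (x\<^sub>2, A\<^sub>2)) / 2\<close> with \<open>\<lambda>\<close> kept (the case \<open>\<alpha>\<^sub>I = 0\<close>), and a
  jump \<open>(x, A, \<lambda>) \<mapsto> (x, A - 1, \<lambda> - x\<^sup>r)\<close> (the case \<open>\<alpha>\<^sub>I = 1\<close>); the game is won once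
  \<open>\<lambda> \<le> 0\<close>. Hence \<open>B\<close> is the least non-negative function that equals \<open>1\<close> for \<open>\<lambda> \<le> 0\<close>, is midpoint
  concave in \<open>(x, A)\<close>, and does not decrease when jumps are read backwards. By homogeneity
  only \<open>\<lambda> = 1\<close> matters, and there the backward jump is
  \<open>(w, A) \<mapsto> (\<psi>(2 w), A + 1)\<close> with \<open>\<psi>(y) = y / (2\<^sup>r + y\<^sup>r)\<^sup>1\<^sup>/\<^sup>r\<close>.

  The sequence \<open>\<omega>\<close> is the \<open>\<psi>\<close>-orbit of \<open>2\<close>: \<open>\<omega>\<^sub>0 = \<psi>(2)\<close> and \<open>\<omega>\<^sub>n\<^sub>+\<^sub>1 = \<psi>(\<omega>\<^sub>n)\<close>. So all
  cases of the explicit function come from one piecewise linear function \<open>F\<close> with nodes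
  \<open>2, \<omega>\<^sub>0, \<omega>\<^sub>1, \<dots>\<close> and values \<open>2, 1, 1/2, \<dots>\<close>: it is the minimum of \<open>1\<close>, \<open>A\<close> and
  \<open>(A / 2) F(2 w / A)\<close>. Since \<open>\<psi>' \<le> 1/2\<close>, the slopes of \<open>F\<close> decrease from left to right,
  \<open>F\<close> is concave, and the explicit function is the infimum of the affine functions
  \<open>1\<close>, \<open>A\<close> and the planes over the segments (\<open>explicit_M_eq_envelope\<close>).

  Upper bound: an infimum of affine functions is concave, and it is monotone along jumps
  because \<open>\<psi>\<close> is concave and maps nodes to nodes (\<open>envelope_jump\<close>). Induction on the
  generation then bounds the set where finitely many generations already reach \<open>\<lambda>\<close>
  (\<open>measure_hit_le_potential\<close>). By the Carleson condition and the Borel-Cantelli lemma almost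
  every point lies in only finitely many intervals with \<open>\<alpha>\<^sub>J = 1\<close>, so these sets exhaust the
  level set up to a null set (\<open>measure_tower_level_set\<close>).

  Lower bound: the supremum of the values reached by gluing competitors on the two halves
  (\<open>attainable_glue\<close>) is midpoint concave and monotone along jumps. Being bounded, it is
  concave, so it suffices to estimate it at the vertices of the linear pieces
  (\<open>best_value_node\<close>, \<open>best_value_eq_1\<close>, \<open>envelope_le_best_value\<close>).
\<close>

section \<open>The map linking consecutive nodes\<close>

text \<open>
  Read backwards, a jump turns \<open>(w, B)\<close> into \<open>(\<psi>(2 w), B + 1)\<close>; the
  factor \<open>2\<close> makes the orbit of \<open>2\<close> under \<open>\<psi>\<close> run
  through the numbers \<open>\<omega>\<^sub>n\<close>.
\<close>

definition psi :: "real \<Rightarrow> real \<Rightarrow> real" where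
  "psi r y = y / (2 powr r + y powr r) powr (1 / r)"

lemma psi_0 [simp]: "psi r 0 = 0"
  by (simp add: psi_def)

lemma psi_radicand_pos: "2 powr r + y powr r > 0" for r y :: real
  by (simp add: add_pos_nonneg)

lemma psi_pos: "y > 0 \<Longrightarrow> psi r y > 0"
  unfolding psi_def using psi_radicand_pos[of r y] by simp

lemma psi_root_ge_2:
  fixes r y :: real
  assumes "r > 0" "y \<ge> 0"
  shows "2 \<le> (2 powr r + y powr r) powr (1 / r)"
proof -
  have "(2 powr r) powr (1 / r) \<le> (2 powr r + y powr r) powr (1 / r)"
    using assms by (intro powr_mono2) auto
  then show ?thesis using assms by (simp add: powr_powr)
qed

lemma psi_le_half: "r > 0 \<Longrightarrow> y \<ge> 0 \<Longrightarrow> psi r y \<le> y / 2"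
  unfolding psi_def using psi_root_ge_2[of r y] by (intro divide_left_mono) auto

text \<open>
  Along a ray from the origin only the radicand changes, and it shrinks with the argument.
\<close>

lemma psi_scale:
  assumes "r > 0" "0 \<le> B" "B \<le> 1" "y \<ge> 0"
  shows "B * psi r y \<le> psi r (B * y)"
proof -
  have "(B * y) powr r \<le> y powr r"
    using assms by (intro powr_mono2) (auto intro: mult_left_le_one_le)
  then have "(2 powr r + (B * y) powr r) powr (1 / r) \<le> (2 powr r + y powr r) powr (1 / r)"
    using assms by (intro powr_mono2) auto
  moreover have "0 < (2 powr r + (B * y) powr r) powr (1 / r)"
    using psi_radicand_pos[of r "B * y"] by simp
  ultimately show ?thesis
    unfolding psi_def times_divide_eq_right
    using assms psi_radicand_pos[of r y] psi_radicand_pos[of r "B * y"]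
    by (intro divide_left_mono mult_pos_pos) auto
qed

lemma psi_has_derivative:
  assumes "r > 0" "y > 0"
  shows "(psi r has_real_derivative 2 powr r * (2 powr r + y powr r) powr (- 1 / r - 1)) (at y)"
proof -
  define S where "S = 2 powr r + y powr r"
  have S: "S > 0" using assms by (auto simp: S_def intro: add_pos_nonneg)
  have eq: "psi r = (\<lambda>y. y * (2 powr r + y powr r) powr (- (1 / r)))"
    by (simp add: psi_def powr_minus divide_inverse fun_eq_iff)
  have "((\<lambda>y. y * (2 powr r + y powr r) powr (- (1 / r))) has_real_derivative
      S powr (- (1 / r)) - (y * y powr (r - 1)) * S powr (- (1 / r) - 1)) (at y)"
    using assms S unfolding S_def
    by (auto intro!: derivative_eq_intros)
  moreover have "S powr (- (1 / r)) = S powr (- (1 / r) - 1) * S"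
    using S by (simp add: powr_diff)
  moreover have "y * y powr (r - 1) = y powr r"
    using assms by (simp add: powr_diff)
  moreover have "S = 2 powr r + y powr r" by (simp add: S_def)
  ultimately show ?thesis
    unfolding eq by (simp add: algebra_simps)
qed

text \<open>
  The derivative decreases in \<open>y\<close>, because the base \<open>2\<^sup>r +
  y\<^sup>r\<close> increases and the exponent is negative.
\<close>

lemma psi_concave:
  assumes "r > 0"
  shows "concave_on {0<..} (psi r)"
  unfolding concave_on_def
proof (rule convex_on_realI)
  show "((\<lambda>y. - psi r y) has_real_derivative
      - (2 powr r * (2 powr r + y powr r) powr (- 1 / r - 1))) (at y)" if "y \<in> {0<..}" for y
    using psi_has_derivative[of r y] assms that by (intro DERIV_minus) auto
next
  fix x y :: real assume xy: "x \<in> {0<..}" "y \<in> {0<..}" "x \<le> y"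
  have "(2 powr r + y powr r) powr (- 1 / r - 1) \<le> (2 powr r + x powr r) powr (- 1 / r - 1)"
  proof (rule powr_mono2')
    have "0 \<le> 1 / r" using assms by simp
    then show "- 1 / r - 1 \<le> 0" by linarith
  qed (use xy assms in \<open>auto intro: add_pos_nonneg powr_mono2\<close>)
  then show "- (2 powr r * (2 powr r + x powr r) powr (- 1 / r - 1))
      \<le> - (2 powr r * (2 powr r + y powr r) powr (- 1 / r - 1))"
    by simp
qed (simp add: connected_Ioi)

lemma psi_mono:
  assumes "r > 0" "0 < x" "x \<le> y"
  shows "psi r x \<le> psi r y"
proof (rule DERIV_nonneg_imp_nondecreasing[OF assms(3)])
  show "\<exists>d. (psi r has_real_derivative d) (at t) \<and> 0 \<le> d" if "x \<le> t" "t \<le> y" for t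
    using psi_has_derivative[of r t] assms that
    by (intro exI[of _ "2 powr r * (2 powr r + t powr r) powr (- 1 / r - 1)"]) auto
qed

text \<open>
  The derivative is largest as \<open>y\<close> tends to \<open>0\<close>, where it tends to
  \<open>1/2\<close>. This is the source of the concavity of the piecewise linear profile:
  consecutive gaps between nodes at least halve while the values halve exactly.
\<close>

lemma psi_contract:
  assumes "r > 0" "0 < x" "x \<le> y"
  shows "psi r y - psi r x \<le> (y - x) / 2"
proof -
  have "x / 2 - psi r x \<le> y / 2 - psi r y"
  proof (rule DERIV_nonneg_imp_nondecreasing[OF assms(3)])
    fix t assume t: "x \<le> t" "t \<le> y"
    have "((\<lambda>y. y / 2 - psi r y) has_real_derivative
        1 / 2 - 2 powr r * (2 powr r + t powr r) powr (- 1 / r - 1)) (at t)"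
      using psi_has_derivative[of r t] assms t by (auto intro!: derivative_eq_intros)
    moreover have "(2 powr r + t powr r) powr (- 1 / r - 1) \<le> (2 powr r) powr (- 1 / r - 1)"
    proof (rule powr_mono2')
      have "0 \<le> 1 / r" using assms by simp
      then show "- 1 / r - 1 \<le> 0" by linarith
    qed (use assms in auto)
    then have "2 powr r * (2 powr r + t powr r) powr (- 1 / r - 1) \<le>
        2 powr r * (2 powr r) powr (- 1 / r - 1)"
      by (rule mult_left_mono) simp
    moreover have "2 powr r * (2 powr r) powr (- 1 / r - 1) = (1 / 2 :: real)"
    proof -
      have "2 powr r * (2 powr r) powr (- 1 / r - 1) = (2::real) powr (r + r * (- 1 / r - 1))"
        by (simp only: powr_powr powr_add)
      also have "r + r * (- 1 / r - 1) = - 1" using assms by (simp add: field_simps)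
      finally show ?thesis by (simp add: powr_minus)
    qed
    ultimately show "\<exists>d. ((\<lambda>y. y / 2 - psi r y) has_real_derivative d) (at t) \<and> 0 \<le> d"
      by (smt (verit))
  qed
  then show ?thesis by (simp add: field_simps)
qed

text \<open>
  Normalising the level after a jump, from \<open>l - x\<^sup>r\<close> to \<open>1\<close>, and
  normalising it before the jump, from \<open>l\<close> to \<open>1\<close>, give two abscissas;
  \<open>\<psi>\<close> links them.
\<close>

lemma psi_level_change:
  assumes "r > 0" "x \<ge> 0" "x powr r < l"
  shows "psi r (2 * (x / (l - x powr r) powr (1 / r))) = x / l powr (1 / r)"
proof -
  define m where "m = l - x powr r"
  have m: "m > 0" using assms by (simp add: m_def)
  have l: "l > 0" using assms by (smt (verit) powr_ge_zero)
  define w where "w = x / m powr (1 / r)"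
  have "(2 * w) powr r = 2 powr r * (x powr r / m)"
    using assms m by (simp add: w_def powr_mult powr_divide powr_powr)
  then have "2 powr r + (2 * w) powr r = 2 powr r * (l / m)"
    using m by (simp add: m_def field_simps)
  then have "(2 powr r + (2 * w) powr r) powr (1 / r) = 2 * (l powr (1 / r) / m powr (1 / r))"
    using assms m l by (simp add: powr_mult powr_divide powr_powr)
  then show ?thesis
    unfolding psi_def using m by (simp add: w_def m_def)
qed

text \<open>
  The sequence \<open>\<omega>\<close> is prolonged by \<open>2\<close>, its preimage under
  \<open>\<psi>\<close>. The segment between \<open>\<omega>\<^sub>0\<close> and \<open>2\<close>
  then carries the region \<open>Delta0\<close>, on which the explicit function is the homogeneous
  extension of a linear piece just as on \<open>Delta\<close>.
\<close>

primrec node :: "real \<Rightarrow> nat \<Rightarrow> real" where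
  "node r 0 = 2"
| "node r (Suc n) = omega r n"

lemma omega_powr:
  assumes "r > 0"
  shows "omega r n > 0" and
    "omega r n powr r = (2 powr r - 1) / (2 powr (real n * r) * (2 powr (r + 1) - 1) - 1)"
    and "2 powr (real n * r) * (2 powr (r + 1) - 1) > (1::real)"
proof -
  have "(1::real) \<le> 2 powr (real n * r)" using assms by (intro ge_one_powr_ge_zero) auto
  moreover have r1: "(1::real) < 2 powr r" using assms by simp
  then have "(1::real) < 2 powr (r + 1) - 1" by (simp add: powr_add)
  ultimately show *: "2 powr (real n * r) * (2 powr (r + 1) - 1) > (1::real)"
    by (metis less_1_mult less_eq_real_def mult_1)
  then show "omega r n > 0" unfolding omega_def using r1 assms by simp
  from * r1 have "0 \<le> (2 powr r - 1) / (2 powr (real n * r) * (2 powr (r + 1) - 1) - 1)"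
    by (intro divide_nonneg_nonneg) linarith+
  with assms show "omega r n powr r = (2 powr r - 1) / (2 powr (real n * r) * (2 powr (r + 1) - 1) - 1)"
    unfolding omega_def powr_powr by (simp del: abs_divide add: abs_of_nonneg)
qed

lemma node_pos: "r > 0 \<Longrightarrow> node r n > 0"
  by (cases n) (auto simp: omega_powr(1))

lemma omega_0: "r > 0 \<Longrightarrow> omega r 0 = (1 / 2) powr (1 / r)"
proof -
  assume "r > 0"
  then have "(2 powr r - 1) / (2 powr (real 0 * r) * (2 powr (r + 1) - 1) - 1) = (1 / 2 :: real)"
    by (simp add: powr_add field_simps)
  then show ?thesis by (simp only: omega_def)
qed

lemma omega_0_bounds:
  assumes "r > 0"
  shows "0 < omega r 0" "omega r 0 < 1"
  using omega_powr(1)[OF assms, of 0] powr_less_mono'[of "1 / 2" 0 "1 / r"] omega_0[OF assms] assms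
  by auto

text \<open>
  With \<open>u\<^sub>n = \<omega>\<^sub>n\<close> to the power \<open>-r\<close> the claim is the
  recursion \<open>u\<^sub>n\<^sub>+\<^sub>1 = 1 + 2\<^sup>r u\<^sub>n\<close>, which the closed
  form of \<open>\<omega>\<^sub>n\<close> solves with \<open>u\<^sub>0 = 2\<close>.
\<close>

lemma node_Suc:
  assumes "r > 0"
  shows "node r (Suc n) = psi r (node r n)"
proof -
  have p: "(2 powr r + y powr r) > (0::real)" for y by (auto intro: add_pos_nonneg)
  have *: "psi r y powr r = y powr r / (2 powr r + y powr r)" if "y > 0" for y
    unfolding psi_def using assms that p[of y] by (simp add: powr_divide powr_powr)
  have "node r (Suc n) powr r = psi r (node r n) powr r"
  proof (cases n)
    case 0
    then show ?thesis using assms by (simp add: * omega_0 powr_powr)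
  next
    case (Suc m)
    define D where "D = 2 powr (real m * r) * (2 powr (r + 1) - 1) - (1::real)"
    define q where "q = (2::real) powr r"
    have D: "D > 0" using omega_powr(3)[OF assms, of m] by (simp add: D_def)
    have q: "q > 1" using assms by (simp add: q_def)
    have E: "2 powr (real (Suc m) * r) * (2 powr (r + 1) - 1) - 1 = q * (D + 1) - (1::real)"
      by (simp add: D_def q_def algebra_simps powr_add)
    have "node r (Suc n) powr r = (q - 1) / (q * (D + 1) - 1)"
      using omega_powr(2)[OF assms, of "Suc m"] unfolding E using Suc by (simp add: q_def)
    moreover have "node r n powr r = (q - 1) / D"
      using omega_powr(2)[OF assms, of m] Suc by (simp add: D_def q_def)
    moreover have "psi r (node r n) powr r = node r n powr r / (q + node r n powr r)"
      using *[OF node_pos[OF assms]] by (simp add: q_def)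
    moreover
have "(q - 1) / (q * (D + 1) - 1) = ((q - 1) / D) / (q + (q - 1) / D)"
    proof -
      have "q + (q - 1) / D = (q * (D + 1) - 1) / D" using D by (simp add: field_simps)
      then show ?thesis using D by simp
    qed
    ultimately show ?thesis by simp
  qed
  then have "(node r (Suc n) powr r) powr (1 / r) = (psi r (node r n) powr r) powr (1 / r)"
    by simp
  then show ?thesis
    using assms node_pos[OF assms, of "Suc n"] psi_pos[OF node_pos[OF assms], of r n]
    by (simp add: powr_powr)
qed

lemma node_Suc_le_half: "r > 0 \<Longrightarrow> node r (Suc n) \<le> node r n / 2"
  by (metis node_Suc psi_le_half node_pos less_eq_real_def)

lemma node_Suc_less: "r > 0 \<Longrightarrow> node r (Suc n) < node r n"
  using node_Suc_le_half[of r n] node_pos[of r n] by linarith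

lemma node_decreasing: "r > 0 \<Longrightarrow> m \<le> n \<Longrightarrow> node r n \<le> node r m"
  by (rule lift_Suc_antimono_le[of "node r"]) (simp_all only: less_imp_le[OF node_Suc_less])

lemma node_le: "r > 0 \<Longrightarrow> node r n \<le> 2 / 2 ^ n"
proof (induction n)
  case (Suc n)
  then show ?case using node_Suc_le_half[of r n] by simp
qed auto

lemma node_segment_exists:
  assumes "r > 0" "0 < y" "y \<le> 2"
  obtains k where "node r (Suc k) \<le> y" "y < node r k \<or> k = 0"
proof -
  obtain n where n: "2 / y < 2 ^ n" using real_arch_pow[of 2 "2 / y"] by auto
  then have "2 / 2 ^ n < y" using assms by (simp add: field_simps)
  then have "node r n \<le> y" using node_le[OF assms(1), of n] by simp
  then have ex: "node r (Suc n) \<le> y" using node_Suc_less[OF assms(1), of n] by linarith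
  define k where "k = (LEAST n. node r (Suc n) \<le> y)"
  have "node r (Suc k) \<le> y" unfolding k_def using ex by (rule LeastI)
  moreover have "y < node r k \<or> k = 0"
    using not_less_Least[of "k - 1" "\<lambda>n. node r (Suc n) \<le> y"] unfolding k_def[symmetric]
    by (cases k) auto
  ultimately show ?thesis using that by blast
qed

section \<open>The explicit function as an infimum of affine functions\<close>

definition slope :: "real \<Rightarrow> nat \<Rightarrow> real" where
  "slope r n = 1 / (2 ^ n * (node r n - node r (Suc n)))"

text \<open>
  The affine function through \<open>(node r (n + 1), 1 / 2\<^sup>n)\<close> and \<open>(node r n, 2
  / 2\<^sup>n)\<close>, one of the linear pieces of the profile \<open>F\<close>.
\<close>

definition chord :: "real \<Rightarrow> nat \<Rightarrow> real \<Rightarrow> real" where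
  "chord r n y = 1 / 2 ^ n + slope r n * (y - node r (Suc n))"

lemma slope_pos: "r > 0 \<Longrightarrow> slope r n > 0"
  using node_Suc_less[of r n] by (simp add: slope_def)

lemma slope_mono:
  assumes "r > 0"
  shows "slope r n \<le> slope r (Suc n)"
proof -
  have "node r (Suc n) - node r (Suc (Suc n)) \<le> (node r n - node r (Suc n)) / 2"
    using psi_contract[OF assms node_pos[OF assms] less_imp_le[OF node_Suc_less[OF assms]], of n]
    by (simp only: node_Suc[OF assms, symmetric])
  then show ?thesis
    unfolding slope_def using node_Suc_less[OF assms, of n] node_Suc_less[OF assms, of "Suc n"]
    by (intro divide_left_mono) (auto simp del: node.simps)
qed

lemma chord_nodes:
  assumes "r > 0"
  shows "chord r n (node r (Suc n)) = 1 / 2 ^ n" "chord r n (node r n) = 2 / 2 ^ n"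
  using node_Suc_less[OF assms, of n] by (auto simp: chord_def slope_def field_simps simp del: node.simps)

lemma chord_Suc_diff:
  assumes "r > 0"
  shows "chord r (Suc n) y - chord r n y = (slope r (Suc n) - slope r n) * (y - node r (Suc n))"
proof -
  have "chord r m y = chord r m z + slope r m * (y - z)" for m z
    by (simp add: chord_def algebra_simps)
  from this[of "Suc n" "node r (Suc n)"] this[of n "node r (Suc n)"]
  show ?thesis using chord_nodes[OF assms] by (simp add: algebra_simps del: node.simps)
qed

lemma chord_mono: "r > 0 \<Longrightarrow> y \<le> z \<Longrightarrow> chord r n y \<le> chord r n z"
  using slope_pos[of r n] by (simp add: chord_def mult_left_mono)

text \<open>
  The profile \<open>F\<close> is concave. Neighbouring chords meet at the common node and their
  slopes increase with the index. So to the right of that node the chord of smaller index is the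
  lower one, and to its left the other one; moving away from the segment of \<open>y\<close> in
  either direction only increases the value.
\<close>

lemma chord_minimal:
  assumes "r > 0" "node r (Suc k) \<le> y" "y \<le> node r k"
  shows "chord r k y \<le> chord r n y"
proof (cases "k \<le> n")
  case True
  then show ?thesis
  proof (induction n rule: dec_induct)
    case (step n)
    have "node r (Suc n) \<le> y" using node_decreasing[of r "Suc k" "Suc n"] step assms by linarith
    then have "chord r n y \<le> chord r (Suc n) y"
      using chord_Suc_diff[OF assms(1), of n y] slope_mono[OF assms(1), of n]
      by (smt (verit) mult_nonneg_nonneg)
    then show ?case using step by linarith
  qed auto
next
  case False
  then have "n \<le> k" by simp
  then show ?thesis
  proof (induction n rule: inc_induct)
    case (step n)
    have "y \<le> node r (Suc n)" using node_decreasing[of r "Suc n" k] step assms by linarith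
    then have "chord r (Suc n) y \<le> chord r n y"
      using chord_Suc_diff[OF assms(1), of n y] slope_mono[OF assms(1), of n]
      by (smt (verit) mult_nonneg_nonpos)
    then show ?case using step by linarith
  qed auto
qed

text \<open>
  This is \<open>F(\<psi>(y)) \<ge> F(y) / 2\<close>, the case \<open>B = 1\<close> of monotonicity
  along jumps: both sides agree at the ends of the segment, because \<open>\<psi>\<close> maps nodes
  to nodes while the values halve; in between the right side is linear and the left side concave, as
  \<open>\<psi>\<close> is concave and chords increase.
\<close>

lemma chord_psi_ge:
  assumes "r > 0" "node r (Suc k) \<le> y" "y \<le> node r k"
  shows "chord r k y / 2 \<le> chord r (Suc k) (psi r y)"
proof -
  define t where "t = (y - node r (Suc k)) / (node r k - node r (Suc k))"
  have d: "node r k - node r (Suc k) > 0" "node r (Suc k) - node r (Suc (Suc k)) > 0"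
    using node_Suc_less[OF assms(1)] by (auto simp del: node.simps)
  have t: "0 \<le> t" "t \<le> 1" using assms d by (auto simp: t_def field_simps simp del: node.simps)
  have "t * (node r k - node r (Suc k)) = y - node r (Suc k)"
    using d by (simp add: t_def del: node.simps)
  then have y: "y = (1 - t) *\<^sub>R node r (Suc k) + t *\<^sub>R node r k"
    by (simp add: algebra_simps del: node.simps)
  have "(1 - t) * psi r (node r (Suc k)) + t * psi r (node r k) \<le> psi r y"
    unfolding y using t node_pos[OF assms(1)]
    by (intro concave_onD[OF psi_concave[OF assms(1)]]) (auto simp del: node.simps)
  then have "node r (Suc (Suc k)) + t * (node r (Suc k) - node r (Suc (Suc k))) \<le> psi r y"
    unfolding node_Suc[OF assms(1), symmetric] by (simp add: algebra_simps del: node.simps)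
  from chord_mono[OF assms(1) this, of "Suc k"]
  have "1 / 2 ^ Suc k + slope r (Suc k) * (t * (node r (Suc k) - node r (Suc (Suc k))))
      \<le> chord r (Suc k) (psi r y)" by (simp add: chord_def del: node.simps)
  moreover have "slope r (Suc k) * (t * (node r (Suc k) - node r (Suc (Suc k)))) = t / 2 ^ Suc k"
    using d by (simp add: slope_def del: node.simps)
  moreover have "chord r k y = (1 + t) / 2 ^ k"
    using d by (simp add: chord_def slope_def t_def field_simps del: node.simps)
  ultimately show ?thesis by (simp add: add_divide_distrib del: node.simps)
qed

text \<open>
  The homogeneous extension \<open>(A/2) * chord r n (2 w / A)\<close>, written so that it makes
  sense at \<open>A = 0\<close>.
\<close>

definition plane :: "real \<Rightarrow> nat \<Rightarrow> real \<Rightarrow> real \<Rightarrow> real" where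
  "plane r n w A = slope r n * w + A / 2 * (1 / 2 ^ n - slope r n * node r (Suc n))"

lemma plane_eq_chord: "A \<noteq> 0 \<Longrightarrow> plane r n w A = A / 2 * chord r n (2 * w / A)"
  by (simp add: plane_def chord_def field_simps)

lemma plane_0:
  assumes "r > 0"
  shows "plane r 0 w A = (w + (1 - omega r 0) * A) / (2 - omega r 0)"
proof -
  define o0 where "o0 = omega r 0"
  have o0: "o0 < 1" using omega_0_bounds(2)[OF assms] by (simp add: o0_def)
  define Q where "Q = (1 - o0) / (2 - o0)"
  have "plane r 0 w A = (1 / (2 - o0)) * w + A / 2 * (1 - (1 / (2 - o0)) * o0)"
    by (simp add: plane_def slope_def o0_def[symmetric])
  also have "1 - (1 / (2 - o0)) * o0 = 2 * Q" using o0 by (simp add: Q_def field_simps)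
  also have "A / 2 * (2 * Q) = A * Q" by simp
  also have "A * Q = (1 - o0) * A / (2 - o0)" by (simp add: Q_def)
  finally show ?thesis by (simp add: add_divide_distrib o0_def)
qed

text \<open>
  Each node is at most half of its predecessor, so the chords have non-negative intercepts. That is
  what makes the planes increase in \<open>A\<close>.
\<close>

lemma plane_intercept_nonneg:
  assumes "r > 0"
  shows "1 / 2 ^ n - slope r n * node r (Suc n) \<ge> 0"
proof -
  have "node r (Suc n) / (node r n - node r (Suc n)) \<le> 1"
    using node_Suc_le_half[OF assms, of n] node_Suc_less[OF assms, of n] by (simp del: node.simps)
  then have "node r (Suc n) / (node r n - node r (Suc n)) / 2 ^ n \<le> 1 / 2 ^ n"
    by (rule divide_right_mono) simp
  then show ?thesis by (simp add: slope_def mult.commute del: node.simps)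
qed

lemma plane_mono:
  assumes "r > 0" "A \<le> A'"
  shows "plane r n w A \<le> plane r n w A'"
  unfolding plane_def using plane_intercept_nonneg[OF assms(1), of n] assms
  by (auto intro!: mult_right_mono simp del: node.simps)

lemma plane_nonneg:
  assumes "r > 0" "w \<ge> 0" "A \<ge> 0"
  shows "plane r n w A \<ge> 0"
  using plane_intercept_nonneg[OF assms(1), of n] slope_pos[OF assms(1), of n] assms
  unfolding plane_def by (auto intro!: add_nonneg_nonneg mult_nonneg_nonneg simp del: node.simps)

definition envelope :: "real \<Rightarrow> real \<Rightarrow> real \<Rightarrow> real" where
  "envelope r w A = min 1 (min A (INF n. plane r n w A))"

lemma le_envelope_iff:
  assumes "r > 0" "w \<ge> 0" "A \<ge> 0"
  shows "v \<le> envelope r w A \<longleftrightarrow> v \<le> 1 \<and> v \<le> A \<and> (\<forall>n. v \<le> plane r n w A)"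
proof -
  have "bdd_below (range (\<lambda>n. plane r n w A))"
    using plane_nonneg[OF assms] by (intro bdd_belowI[of _ 0]) auto
  then show ?thesis by (auto simp: envelope_def le_cINF_iff)
qed

lemma envelope_le:
  assumes "r > 0" "w \<ge> 0" "A \<ge> 0"
  shows "envelope r w A \<le> 1" "envelope r w A \<le> A" "envelope r w A \<le> plane r n w A"
  using le_envelope_iff[OF assms, of "envelope r w A"] by auto

text \<open>
  An infimum of affine functions is concave.
\<close>

lemma envelope_midpoint:
  assumes "r > 0" "w1 \<ge> 0" "A1 \<ge> 0" "w2 \<ge> 0" "A2 \<ge> 0"
  shows "(envelope r w1 A1 + envelope r w2 A2) / 2 \<le> envelope r ((w1 + w2) / 2) ((A1 + A2) / 2)"
proof -
  note l = envelope_le[OF assms(1-3)] envelope_le[OF assms(1,4,5)]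
  have "(envelope r w1 A1 + envelope r w2 A2) / 2 \<le> plane r n ((w1 + w2) / 2) ((A1 + A2) / 2)" for n
  proof -
    have "plane r n ((w1 + w2) / 2) ((A1 + A2) / 2) = (plane r n w1 A1 + plane r n w2 A2) / 2"
      by (simp add: plane_def field_simps)
    then show ?thesis
      using envelope_le(3)[OF assms(1-3), of n] envelope_le(3)[OF assms(1,4,5), of n] by simp
  qed
  then show ?thesis using assms l(1,2,4,5) by (subst le_envelope_iff) auto
qed

text \<open>
  With \<open>F\<close> constant beyond \<open>2\<close>, let \<open>N(w, A) = (A/2) F(2w/A)\<close>
  and \<open>z = 2w/B\<close>. Monotonicity in \<open>A\<close>, homogeneity, \<open>B \<psi>(z)
  \<le> \<psi>(B z)\<close> and the case \<open>B = 1\<close> give \<open>N(\<psi>(2w), 1 + B) \<ge>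
  N(\<psi>(2w), 2B) \<ge> B N(\<psi>(z), 2) \<ge> B N(z/2, 1) = N(w, B)\<close>. The bounds are
  checked plane by plane on the side of \<open>\<psi>(2w)\<close>.
\<close>

lemma envelope_jump:
  assumes "r > 0" "w \<ge> 0" "0 \<le> B" "B \<le> 1"
  shows "envelope r w B \<le> envelope r (psi r (2 * w)) (1 + B)"
proof -
  have psi: "psi r (2 * w) \<ge> 0" using psi_pos[of "2 * w" r] assms(2) by (cases "w = 0") auto
  have "envelope r w B \<le> plane r n (psi r (2 * w)) (1 + B)" for n
  proof (cases "w = 0 \<or> B = 0")
    case True
    then show ?thesis
    proof
      assume "w = 0"
      then show ?thesis
        using envelope_le(3)[OF assms(1-3), of n] plane_mono[OF assms(1), of B "1 + B" n 0] by simp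
    next
      assume "B = 0"
      then show ?thesis
        using envelope_le(2)[OF assms(1-3)] plane_nonneg[OF assms(1) psi, of "1 + B" n] by simp
    qed
  next
    case False
    with assms have w: "w > 0" and B: "B > 0" by auto
    define z where "z = 2 * w / B"
    have z: "z > 0" "2 * w = B * z" using w B by (auto simp: z_def)
    have "B * chord r n (psi r z) \<le> plane r n (psi r (2 * w)) (1 + B)"
    proof -
      have "psi r z \<le> psi r (2 * w) / B"
        using psi_scale[of r B z] z assms B by (simp add: field_simps)
      then have "B * chord r n (psi r z) \<le> B * chord r n (psi r (2 * w) / B)"
        using chord_mono[OF assms(1)] B by simp
      also have "\<dots> = plane r n (psi r (2 * w)) (2 * B)"
        using B by (simp add: plane_eq_chord)
      also have "\<dots> \<le> plane r n (psi r (2 * w)) (1 + B)"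
        using assms by (intro plane_mono) auto
      finally show ?thesis .
    qed
    moreover have "envelope r w B \<le> B * chord r n (psi r z)"
    proof (cases "z \<le> 2")
      case True
      from node_segment_exists[OF assms(1) z(1) this]
      obtain k where k: "node r (Suc k) \<le> z" "z < node r k \<or> k = 0" by blast
      have k2: "z \<le> node r k" using k(2) True by auto
      \<comment> \<open>\<open>\<psi>\<close> maps segment \<open>k\<close> to segment \<open>k + 1\<close>, where the chord of index \<open>k + 1\<close> is the lowest one.\<close>
      have "envelope r w B \<le> plane r k w B" using envelope_le(3) assms by simp
      also have "\<dots> = B * (chord r k z / 2)" using B by (simp add: plane_eq_chord z_def)
      also have "\<dots> \<le> B * chord r (Suc k) (psi r z)"
        using chord_psi_ge[OF assms(1) k(1) k2] B by (simp only: mult_le_cancel_left_pos)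
      also have "\<dots> \<le> B * chord r n (psi r z)"
      proof -
        have "psi r (node r (Suc k)) \<le> psi r z" "psi r z \<le> psi r (node r k)"
          using k(1) k2 z(1) node_pos[OF assms(1), of "Suc k"] psi_mono[OF assms(1)] by auto
        then show ?thesis
          using chord_minimal[OF assms(1), of "Suc k" "psi r z" n] B
          by (simp add: node_Suc[OF assms(1), symmetric] del: node.simps)
      qed
      finally show ?thesis .
    next
      case False
      have "psi r 2 \<le> psi r z" using psi_mono[of r 2 z] assms False by simp
      then have "chord r n (node r 1) \<le> chord r n (psi r z)"
        using node_Suc[OF assms(1), of 0] chord_mono[OF assms(1)] by simp
      moreover have "1 \<le> chord r n (node r 1)"
        using chord_minimal[OF assms(1), of 0 "node r 1" n] chord_nodes(1)[OF assms(1), of 0]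
          node_Suc_less[OF assms(1), of 0] by simp
      ultimately have "B * 1 \<le> B * chord r n (psi r z)" using B by (intro mult_left_mono) auto
      then show ?thesis using envelope_le(2)[OF assms(1-3)] by simp
    qed
    ultimately show ?thesis by simp
  qed
  then show ?thesis
    using envelope_le[OF assms(1-3)] psi assms by (subst le_envelope_iff) auto
qed

lemma envelope_eq_min_plane:
  assumes "r > 0" "A > 0" "w \<ge> 0" "node r (Suc k) * A \<le> 2 * w" "2 * w \<le> node r k * A"
  shows "envelope r w A = min 1 (plane r k w A)"
proof -
  have y: "node r (Suc k) \<le> 2 * w / A" "2 * w / A \<le> node r k"
    using assms by (auto simp: field_simps simp del: node.simps)
  have "plane r k w A \<le> plane r n w A" for n
    using chord_minimal[OF assms(1) y, of n] assms by (simp add: plane_eq_chord)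
  moreover have "plane r k w A \<le> A"
  proof -
    have "chord r k (2 * w / A) \<le> 2 / 2 ^ k" using chord_mono[OF assms(1) y(2), of k] chord_nodes(2) assms by simp
    also have "\<dots> \<le> 2" by (simp add: field_simps)
    finally show ?thesis using assms by (simp add: plane_eq_chord)
  qed
  ultimately have "min 1 (plane r k w A) \<le> envelope r w A"
    using assms by (subst le_envelope_iff) (auto simp: min_le_iff_disj)
  moreover have "envelope r w A \<le> min 1 (plane r k w A)"
    using envelope_le assms by simp
  ultimately show ?thesis by simp
qed

lemma envelope_eq_min:
  assumes "r > 0" "0 \<le> A" "A \<le> w"
  shows "envelope r w A = min 1 A"
proof (rule antisym)
  show "envelope r w A \<le> min 1 A" using envelope_le assms by simp
  have "A \<le> plane r n w A" for n
  proof (cases "A = 0")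
    case False
    with assms have "chord r n 2 \<le> chord r n (2 * w / A)" by (intro chord_mono) (auto simp: field_simps)
    moreover have "2 \<le> chord r n 2"
      using chord_minimal[OF assms(1), of 0 2 n] chord_nodes(2)[OF assms(1), of 0]
        node_Suc_less[OF assms(1), of 0] by simp
    ultimately show ?thesis using assms False by (simp add: plane_eq_chord)
  qed (use plane_nonneg[of r w 0 n] assms in simp)
  then show "min 1 A \<le> envelope r w A" using assms by (subst le_envelope_iff) (auto simp: min_le_iff_disj)
qed

text \<open>
  The intercepts of the chords tend to \<open>0\<close>, so the infimum vanishes on the axis
  \<open>w = 0\<close>.
\<close>

lemma envelope_0:
  assumes "r > 0" "A \<ge> 0" "A \<le> 2"
  shows "envelope r 0 A = 0"
proof (rule antisym)
  show "0 \<le> envelope r 0 A" using assms plane_nonneg by (subst le_envelope_iff) auto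
  have le: "envelope r 0 A \<le> 1 / 2 ^ n" for n
  proof -
    have "envelope r 0 A \<le> A / 2 * (1 / 2 ^ n - slope r n * node r (Suc n))"
      using envelope_le(3)[of r 0 A n] assms by (simp add: plane_def)
    also have "\<dots> \<le> 1 * (1 / 2 ^ n - slope r n * node r (Suc n))"
      using assms plane_intercept_nonneg[of r n] by (intro mult_right_mono) auto
    also have "\<dots> \<le> 1 / 2 ^ n"
      using slope_pos[of r n] node_pos[of r "Suc n"] assms by simp
    finally show ?thesis .
  qed
  show "envelope r 0 A \<le> 0"
  proof (rule ccontr)
    assume "\<not> ?thesis"
    then obtain n where "(1 / 2) ^ n < envelope r 0 A"
      using real_arch_pow_inv[of "envelope r 0 A" "1 / 2"] by auto
    then show False using le[of n] by (simp add: power_one_over)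
  qed
qed

text \<open>
  The level is normalised to \<open>1\<close> by homogeneity. For \<open>l \<le> 0\<close> the level
  is already reached, so the value is \<open>1\<close>.
\<close>

definition potential :: "real \<Rightarrow> real \<Rightarrow> real \<Rightarrow> real \<Rightarrow> real" where
  "potential r x A l = (if l \<le> 0 then 1 else envelope r (x / l powr (1 / r)) A)"

lemma potential_nonneg: "r > 0 \<Longrightarrow> x \<ge> 0 \<Longrightarrow> A \<ge> 0 \<Longrightarrow> 0 \<le> potential r x A l"
  unfolding potential_def by (auto simp: le_envelope_iff plane_nonneg)

lemma potential_midpoint:
  assumes "r > 0" "x1 \<ge> 0" "A1 \<ge> 0" "x2 \<ge> 0" "A2 \<ge> 0"
  shows "(potential r x1 A1 l + potential r x2 A2 l) / 2 \<le> potential r ((x1 + x2) / 2) ((A1 + A2) / 2) l"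
proof (cases "l \<le> 0")
  case False
  have eq: "(x1 + x2) / 2 / l powr (1 / r) = (x1 / l powr (1 / r) + x2 / l powr (1 / r)) / 2"
    by (simp add: add_divide_distrib)
  from False show ?thesis unfolding potential_def eq
    using envelope_midpoint[of r "x1 / l powr (1 / r)" A1 "x2 / l powr (1 / r)" A2] assms
    by simp
qed (simp add: potential_def)

text \<open>
  If the jump brings a positive level to \<open>0\<close> or below, the value after it is
  \<open>1\<close>. Then the normalised abscissa before it is at least \<open>1\<close>, and since
  \<open>A \<ge> 1\<close> the value there is \<open>1\<close> as well.
\<close>

lemma potential_jump:
  assumes "r > 0" "x \<ge> 0" "0 \<le> B" "B \<le> 1"
  shows "potential r x B (l - x powr r) \<le> potential r x (1 + B) l"
proof (cases "x powr r < l")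
  case True
  then have "l > 0" by (smt (verit) powr_ge_zero)
  with True show ?thesis
    using envelope_jump[of r "x / (l - x powr r) powr (1 / r)" B] assms psi_level_change[of r x l]
    by (simp add: potential_def)
next
  case False
  show ?thesis
  proof (cases "l \<le> 0")
    case l: False
    have "l powr (1 / r) \<le> (x powr r) powr (1 / r)" using False l assms by (intro powr_mono2) auto
    then have "l powr (1 / r) \<le> x" using assms by (simp add: powr_powr)
    then have w: "1 \<le> x / l powr (1 / r)" using l by simp
    have "1 \<le> envelope r (x / l powr (1 / r)) 1"
      using envelope_eq_min[OF assms(1), of 1] w by simp
    then have "1 \<le> plane r n (x / l powr (1 / r)) 1" for n
      using w assms by (subst (asm) le_envelope_iff) auto
    then have "1 \<le> plane r n (x / l powr (1 / r)) (1 + B)" for n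
      using plane_mono[OF assms(1), of 1 "1 + B" n "x / l powr (1 / r)"] assms by (meson order_trans le_add_same_cancel1)
    then have "1 \<le> envelope r (x / l powr (1 / r)) (1 + B)"
      using w assms by (subst le_envelope_iff) auto
    with l False show ?thesis by (simp add: potential_def)
  next
    case l: True
    have "l - x powr r \<le> 0" using l powr_ge_zero[of x r] by linarith
    then have "potential r x B (l - x powr r) = 1" by (simp add: potential_def)
    then show ?thesis using l by (simp add: potential_def)
  qed
qed

text \<open>
  In the region \<open>A \<le> w\<close> the minimum is taken by \<open>1\<close> or
  \<open>A\<close>. For \<open>w < A\<close> the segment containing \<open>2w/A\<close> decides: on
  the first one the plane with index \<open>0\<close> is at least \<open>1\<close> exactly on
  \<open>Sigma0\<close>; on the others the plane is the formula with \<open>frak_f\<close> and stays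
  below \<open>1\<close>.
\<close>

lemma explicit_M_eq_envelope:
  assumes "r > 0" "w \<ge> 0" "0 \<le> A" "A \<le> 2"
  shows "explicit_M r w A = envelope r w A"
proof -
  define o0 where "o0 = omega r 0"
  have o0: "0 < o0" "o0 < 1" using omega_0_bounds[OF assms(1)] by (auto simp: o0_def)
  have plane0: "plane r 0 w A = (w + (1 - o0) * A) / (2 - o0)"
    using plane_0[OF assms(1)] by (simp add: o0_def)
  have iff: "1 + (1 - w) / (1 - o0) \<le> A \<longleftrightarrow> 1 \<le> plane r 0 w A"
    unfolding plane0 using o0 by (simp add: field_simps)
  show ?thesis
  proof (cases "A \<le> w")
    case True
    have S0: "(w, A) \<in> Sigma0 r \<longleftrightarrow> 1 \<le> A"
    proof
      assume "1 \<le> A"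
      with True have "(1 - w) / (1 - o0) \<le> 0" using o0 by (simp add: divide_nonpos_pos)
      with \<open>1 \<le> A\<close> show "(w, A) \<in> Sigma0 r" using assms by (simp add: Sigma0_def o0_def[symmetric])
    qed (simp add: Sigma0_def)
    show ?thesis
    proof (cases "1 \<le> A \<or> A < w")
      case True
      with \<open>A \<le> w\<close> S0 show ?thesis using assms
        by (auto simp: explicit_M_def Sigma1_def envelope_eq_min)
    next
      case False
      with \<open>A \<le> w\<close> have [simp]: "w = A" and "A < 1" by auto
      have "A \<le> 1 + (1 - A) / (1 - o0)"
        using \<open>A < 1\<close> o0 by (simp add: add_increasing2)
      moreover have "A \<le> 2 * A / o0" using assms o0 mult_left_mono[of o0 2 A] by (simp add: field_simps)
      ultimately have "(w, A) \<in> Delta0 r"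
        using assms by (simp add: Delta0_def o0_def[symmetric])
      moreover have "(w + (1 - o0) * A) / (2 - o0) = A" using o0 by (simp add: field_simps)
      ultimately show ?thesis using S0 False assms
        by (simp add: explicit_M_def Sigma1_def envelope_eq_min o0_def[symmetric])
    qed
  next
    case False
    then have Aw: "w < A" "A > 0" using assms by auto
    have S1: "(w, A) \<notin> Sigma1" using Aw by (simp add: Sigma1_def)
    show ?thesis
    proof (cases "A \<le> 2 * w / o0")
      case True
      then have "o0 * A \<le> 2 * w" using o0 by (simp add: field_simps)
      then have M: "envelope r w A = min 1 (plane r 0 w A)"
        using Aw assms by (intro envelope_eq_min_plane) (auto simp: o0_def)
      show ?thesis
      proof (cases "1 + (1 - w) / (1 - o0) \<le> A")
        case S: True
        have "1 \<le> A"
        proof (rule ccontr)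
          assume "\<not> 1 \<le> A"
          with Aw have "w < 1" by simp
          then have "0 \<le> (1 - w) / (1 - o0)" using o0 by simp
          with S \<open>\<not> 1 \<le> A\<close> show False by linarith
        qed
        then have "(w, A) \<in> Sigma0 r" using S assms by (simp add: Sigma0_def o0_def[symmetric])
        then show ?thesis using M S iff by (simp add: explicit_M_def)
      next
        case S: False
        then have "(w, A) \<notin> Sigma0 r" "(w, A) \<in> Delta0 r"
          using True Aw assms by (auto simp: Sigma0_def Delta0_def o0_def[symmetric])
        then show ?thesis using M S iff S1 plane0 by (simp add: explicit_M_def o0_def[symmetric])
      qed
    next
      case False
      then have wA: "2 * w < o0 * A" using o0 by (simp add: field_simps)
      have "plane r 0 w A < 1"
      proof -
        have "w + (1 - o0) * A < o0 * A / 2 + (1 - o0) * A" using wA by simp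
        also have "\<dots> = (A / 2) * (2 - o0)" by (simp add: field_simps)
        also have "\<dots> \<le> 1 * (2 - o0)" using assms o0 by (intro mult_right_mono) auto
        finally show ?thesis unfolding plane0 using o0 by (simp add: field_simps)
      qed
      then have S0: "(w, A) \<notin> Sigma0 r" using iff by (auto simp: Sigma0_def o0_def[symmetric])
      have D0: "(w, A) \<notin> Delta0 r" "(w, A) \<in> Delta r"
        using False assms by (auto simp: Delta0_def Delta_def o0_def[symmetric])
      have E: "explicit_M r w A = A / 2 * frak_f r (2 * w / A)"
        using S0 S1 D0 by (simp add: explicit_M_def)
      show ?thesis
      proof (cases "w = 0")
        case True
        then show ?thesis using E assms envelope_0 by (simp add: frak_f_def)
      next
        case False
        define y where "y = 2 * w / A"
        have y: "0 < y" "y < node r 1" using False assms Aw wA by (auto simp: y_def o0_def field_simps)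
        then have "y \<le> 2" using node_Suc_less[OF assms(1), of 0] by simp
        from node_segment_exists[OF assms(1) y(1) this] obtain k
          where k: "node r (Suc k) \<le> y" "y < node r k \<or> k = 0" by blast
        with y(2) have k0: "k \<ge> 1" by (cases k) auto
        then have k2: "y < node r k" using k(2) by simp
        obtain j where j: "k = Suc j" using k0 by (cases k) auto
        have the: "(THE n. n \<ge> 1 \<and> omega r n \<le> y \<and> y < omega r (n - 1)) = k"
        proof (rule the_equality)
          show "k \<ge> 1 \<and> omega r k \<le> y \<and> y < omega r (k - 1)" using k k2 j by simp
          fix n assume n: "n \<ge> 1 \<and> omega r n \<le> y \<and> y < omega r (n - 1)"
          then obtain m where m: "n = Suc m" by (cases n) auto
          have "\<not> Suc k \<le> n" using node_decreasing[OF assms(1), of "Suc k" n] n m k(1) by auto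
          moreover have "\<not> Suc n \<le> k" using node_decreasing[OF assms(1), of "Suc n" k] n k2 by auto
          ultimately show "n = k" by simp
        qed
        have "frak_f r y = chord r k y"
          unfolding frak_f_def the using y(1) j by (simp add: chord_def slope_def distrib_left)
        moreover have "envelope r w A = min 1 (plane r k w A)"
          using k k2 Aw assms by (intro envelope_eq_min_plane) (auto simp: y_def field_simps simp del: node.simps)
        moreover have "plane r k w A \<le> 1"
        proof -
          have "chord r k y \<le> 2 / 2 ^ k"
            using chord_mono[OF assms(1) less_imp_le[OF k2], of k] chord_nodes(2)[OF assms(1), of k] by simp
          also have "\<dots> \<le> 1" using j by (simp add: field_simps)
          finally have "A / 2 * chord r k y \<le> 1 * 1"
            using assms Aw slope_pos[OF assms(1), of k] k(1)
            by (intro mult_mono) (auto simp: chord_def intro!: add_nonneg_nonneg mult_nonneg_nonneg simp del: node.simps)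
          then show ?thesis using Aw by (simp add: plane_eq_chord y_def)
        qed
        ultimately show ?thesis unfolding E using Aw by (simp add: plane_eq_chord y_def)
      qed
    qed
  qed
qed

section \<open>Dyadic intervals and Carleson masses\<close>

lemma measure_lebesgue_Ico: "c \<le> d \<Longrightarrow> measure lebesgue {c..<d} = d - c" for c d :: real
  by simp

text \<open>
  The generations are defined by subdividing the smallest intervals. Recursion from the top, through
  the two halves of \<open>I\<close>, is what all inductions below use.
\<close>

lemma dyadic_level_Suc_halves:
  "dyadic_level I (Suc k) = dyadic_level (left_half I) k \<union> dyadic_level (right_half I) k"
  by (induction k) auto

lemma dyadic_unfold: "dyadic I = insert I (dyadic (left_half I) \<union> dyadic (right_half I))"
proof -
  have "dyadic I = dyadic_level I 0 \<union> (\<Union>k. dyadic_level I (Suc k))"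
    unfolding dyadic_def by (subst UNIV_nat_eq) (simp only: UN_insert UN_simps)
  then show ?thesis unfolding dyadic_level_Suc_halves by (auto simp: dyadic_def)
qed

lemma dyadic_self [simp]: "I \<in> dyadic I"
  by (subst dyadic_unfold) simp

lemma dyadic_trans:
  assumes "J \<in> dyadic I"
  shows "dyadic J \<subseteq> dyadic I"
proof -
  obtain j where j: "J \<in> dyadic_level I j" using assms by (auto simp: dyadic_def)
  have "dyadic_level J k \<subseteq> dyadic_level I (j + k)" for k
    using j by (induction k) auto
  then show ?thesis by (fastforce simp: dyadic_def)
qed

lemma finite_dyadic_level: "finite (dyadic_level I k)"
  by (induction k) auto

lemma dyadic_level_interval:
  assumes "a < b" "J \<in> dyadic_level {a..<b} k"
  obtains c d where "J = {c..<d}" "c < d" "a \<le> c" "d \<le> b" "d - c = (b - a) / 2 ^ k"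
proof -
  have "\<exists>c d. J = {c..<d} \<and> c < d \<and> a \<le> c \<and> d \<le> b \<and> d - c = (b - a) / 2 ^ k"
    using assms(2)
  proof (induction k arbitrary: J)
    case (Suc k)
    then obtain K where K: "K \<in> dyadic_level {a..<b} k" "J = left_half K \<or> J = right_half K" by auto
    from Suc.IH[OF K(1)] obtain c d where
      cd: "K = {c..<d}" "c < d" "a \<le> c" "d \<le> b" "d - c = (b - a) / 2 ^ k" by blast
    have "J = {c..<(c + d) / 2} \<or> J = {(c + d) / 2..<d}"
      using K(2) cd(1,2) by (auto simp: left_half_atLeastLessThan right_half_atLeastLessThan)
    moreover have "(c + d) / 2 - c = (b - a) / 2 ^ Suc k" "d - (c + d) / 2 = (b - a) / 2 ^ Suc k"
      using cd(5) by (simp_all add: field_simps)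
    moreover have "c < (c + d) / 2" "(c + d) / 2 < d" using cd(2) by auto
    ultimately show ?case using cd(3,4) by (metis order.trans less_imp_le)
  qed (use assms in auto)
  then show ?thesis using that by blast
qed

lemma dyadic_interval:
  assumes "a < b" "J \<in> dyadic {a..<b}"
  obtains c d where "J = {c..<d}" "c < d" "a \<le> c" "d \<le> b"
  using assms dyadic_level_interval unfolding dyadic_def by (metis UN_E)

lemma dyadic_subset: "a < b \<Longrightarrow> J \<in> dyadic {a..<b} \<Longrightarrow> J \<subseteq> {a..<b}"
  by (erule (1) dyadic_interval) auto

lemma dyadic_halves:
  assumes "a < b"
  shows "dyadic {a..<b} = insert {a..<b} (dyadic {a..<(a + b) / 2} \<union> dyadic {(a + b) / 2..<b})"
  using dyadic_unfold[of "{a..<b}"] assms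
  by (simp add: left_half_atLeastLessThan right_half_atLeastLessThan)

lemma dyadic_halves_disjoint:
  assumes "a < b"
  shows "dyadic {a..<(a + b) / 2} \<inter> dyadic {(a + b) / 2..<b} = {}"
    "{a..<b} \<notin> dyadic {a..<(a + b) / 2}" "{a..<b} \<notin> dyadic {(a + b) / 2..<b}"
proof -
  have m: "a < (a + b) / 2" "(a + b) / 2 < b" using assms by auto
  show "dyadic {a..<(a + b) / 2} \<inter> dyadic {(a + b) / 2..<b} = {}"
  proof (rule ccontr)
    assume "\<not> ?thesis"
    then obtain J where J: "J \<in> dyadic {a..<(a + b) / 2}" "J \<in> dyadic {(a + b) / 2..<b}" by blast
    then have "J \<subseteq> {a..<(a + b) / 2}" "J \<subseteq> {(a + b) / 2..<b}" using dyadic_subset m by blast+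
    moreover obtain c d where "J = {c..<d}" "c < d" using dyadic_interval[OF m(1) J(1)] by blast
    then have "c \<in> J" by simp
    ultimately show False by fastforce
  qed
  show "{a..<b} \<notin> dyadic {a..<(a + b) / 2}"
    using dyadic_subset[OF m(1), of "{a..<b}"] m assms by (auto simp del: ivl_subset dest!: subsetD[of _ _ "(a + b) / 2"])
  show "{a..<b} \<notin> dyadic {(a + b) / 2..<b}"
    using dyadic_subset[OF m(2), of "{a..<b}"] m assms by (auto simp del: ivl_subset dest!: subsetD[of _ _ a])
qed

lemma infsum_dyadic_halves:
  fixes g :: "real set \<Rightarrow> ennreal"
  assumes "a < b"
  shows "infsum g (dyadic {a..<b}) =
    g {a..<b} + (infsum g (dyadic {a..<(a + b) / 2}) + infsum g (dyadic {(a + b) / 2..<b}))"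
proof -
  have "infsum g (dyadic {a..<(a + b) / 2} \<union> dyadic {(a + b) / 2..<b}) =
      infsum g (dyadic {a..<(a + b) / 2}) + infsum g (dyadic {(a + b) / 2..<b})"
    using dyadic_halves_disjoint[OF assms] by (intro infsum_Un_disjoint nonneg_summable_on_complete) auto
  then show ?thesis
    using dyadic_halves_disjoint[OF assms]
    by (subst dyadic_halves[OF assms]) (subst infsum_insert, auto intro!: nonneg_summable_on_complete)
qed

text \<open>
  The unnormalised mass is additive over the halves, which avoids division in
  \<open>ennreal\<close>.
\<close>

definition carleson_mass :: "(real set \<Rightarrow> real) \<Rightarrow> real set \<Rightarrow> ennreal" where
  "carleson_mass \<alpha> J = (\<Sum>\<^sub>\<infinity>K\<in>dyadic J. ennreal (\<alpha> K * measure lebesgue K))"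

lemma carleson_avg_eq_iff:
  assumes "a < b" "0 \<le> q"
  shows "carleson_avg \<alpha> {a..<b} = ennreal q \<longleftrightarrow> carleson_mass \<alpha> {a..<b} = ennreal (q * (b - a))"
proof (cases "carleson_mass \<alpha> {a..<b}")
  case (real m)
  then have "carleson_avg \<alpha> {a..<b} = ennreal (m / (b - a))"
    using assms by (simp add: carleson_avg_def carleson_mass_def divide_ennreal)
  moreover have "m / (b - a) = q \<longleftrightarrow> m = q * (b - a)" using assms by (simp add: field_simps)
  ultimately show ?thesis using real assms by (simp del: ennreal_mult)
next
  case top
  then have "carleson_avg \<alpha> {a..<b} = top"
    using assms by (simp add: carleson_avg_def carleson_mass_def ennreal_top_divide)
  with top show ?thesis by simp
qed

lemma carleson_avg_le_2_iff:
  assumes "a < b"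
  shows "carleson_avg \<alpha> {a..<b} \<le> 2 \<longleftrightarrow> carleson_mass \<alpha> {a..<b} \<le> ennreal (2 * (b - a))"
proof (cases "carleson_mass \<alpha> {a..<b}")
  case (real m)
  then have "carleson_avg \<alpha> {a..<b} = ennreal (m / (b - a))"
    using assms by (simp add: carleson_avg_def carleson_mass_def divide_ennreal)
  moreover have "m / (b - a) \<le> 2 \<longleftrightarrow> m \<le> 2 * (b - a)" using assms by (simp add: field_simps)
  ultimately show ?thesis using real assms
    by (simp flip: ennreal_numeral add: ennreal_le_iff del: ennreal_mult)
next
  case top
  then have "carleson_avg \<alpha> {a..<b} = top"
    using assms by (simp add: carleson_avg_def carleson_mass_def ennreal_top_divide)
  with top show ?thesis by (simp add: top_unique)
qed

lemma carleson_mass_halves: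
  assumes "a < b"
  shows "carleson_mass \<alpha> {a..<b} = ennreal (\<alpha> {a..<b} * (b - a)) +
    (carleson_mass \<alpha> {a..<(a + b) / 2} + carleson_mass \<alpha> {(a + b) / 2..<b})"
  unfolding carleson_mass_def using assms by (subst infsum_dyadic_halves) auto

lemma carleson_mass_cong:
  "(\<And>K. K \<in> dyadic J \<Longrightarrow> \<alpha> K = \<beta> K) \<Longrightarrow> carleson_mass \<alpha> J = carleson_mass \<beta> J"
  unfolding carleson_mass_def by (intro infsum_cong) simp

lemma binary_carleson_iff:
  "\<alpha> \<in> binary_carleson I \<longleftrightarrow> (\<forall>J\<in>dyadic I. \<alpha> J \<in> {0, 1} \<and> carleson_avg \<alpha> J \<le> 2)"
  by (auto simp: binary_carleson_def SUP_le_iff)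

lemma binary_carleson_halves:
  assumes "a < b" "\<alpha> \<in> binary_carleson {a..<b}"
  shows "\<alpha> \<in> binary_carleson {a..<(a + b) / 2}" "\<alpha> \<in> binary_carleson {(a + b) / 2..<b}"
  using assms dyadic_halves[OF assms(1)] by (auto simp: binary_carleson_iff)

definition carleson_real :: "(real set \<Rightarrow> real) \<Rightarrow> real set \<Rightarrow> real" where
  "carleson_real \<alpha> J = enn2real (carleson_avg \<alpha> J)"

lemma carleson_real:
  assumes "\<alpha> \<in> binary_carleson I"
  shows "carleson_avg \<alpha> I = ennreal (carleson_real \<alpha> I)" "0 \<le> carleson_real \<alpha> I"
    "carleson_real \<alpha> I \<le> 2"
proof -
  have le: "carleson_avg \<alpha> I \<le> 2" using assms by (auto simp: binary_carleson_iff)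
  then have "carleson_avg \<alpha> I < top" by (metis ennreal_numeral ennreal_less_top order.strict_trans1)
  then show 1: "carleson_avg \<alpha> I = ennreal (carleson_real \<alpha> I)"
    by (simp add: carleson_real_def)
  show 2: "0 \<le> carleson_real \<alpha> I" by (simp add: carleson_real_def)
  show "carleson_real \<alpha> I \<le> 2"
    using le unfolding 1 by (simp flip: ennreal_numeral add: ennreal_le_iff)
qed

lemma carleson_real_halves:
  assumes "a < b" "\<alpha> \<in> binary_carleson {a..<b}"
  shows "carleson_real \<alpha> {a..<b} = \<alpha> {a..<b} +
    (carleson_real \<alpha> {a..<(a + b) / 2} + carleson_real \<alpha> {(a + b) / 2..<b}) / 2"
proof -
  define m where "m = (a + b) / 2"
  have m: "a < m" "m < b" "m - a = (b - a) / 2" "b - m = (b - a) / 2"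
    using assms by (auto simp: m_def field_simps)
  note h = binary_carleson_halves[OF assms, folded m_def]
  define q0 q1 q2 where q: "q0 = carleson_real \<alpha> {a..<b}" "q1 = carleson_real \<alpha> {a..<m}"
    "q2 = carleson_real \<alpha> {m..<b}"
  have nn: "0 \<le> q0" "0 \<le> q1" "0 \<le> q2" "0 \<le> \<alpha> {a..<b}"
    using carleson_real[OF assms(2)] carleson_real[OF h(1)] carleson_real[OF h(2)] assms(2)
    by (auto simp: q binary_carleson_iff dest!: bspec[of _ _ "{a..<b}"])
  have "carleson_mass \<alpha> {a..<b} = ennreal (q0 * (b - a))"
    "carleson_mass \<alpha> {a..<m} = ennreal (q1 * (m - a))"
    "carleson_mass \<alpha> {m..<b} = ennreal (q2 * (b - m))"
    using carleson_real[OF assms(2)] carleson_real[OF h(1)] carleson_real[OF h(2)] assms m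
    by (simp_all add: q carleson_avg_eq_iff[symmetric])
  with carleson_mass_halves[OF assms(1), of \<alpha>, folded m_def]
  have "ennreal (q0 * (b - a)) = ennreal (\<alpha> {a..<b} * (b - a) + (q1 * (m - a) + q2 * (b - m)))"
    using nn m(1,2) assms(1) by (simp add: ennreal_plus[symmetric] del: ennreal_plus)
  then have "q0 * (b - a) = \<alpha> {a..<b} * (b - a) + (q1 * (m - a) + q2 * (b - m))"
    using nn m(1,2) assms(1) by (subst (asm) ennreal_inj) auto
  also have "\<dots> = (\<alpha> {a..<b} + (q1 + q2) / 2) * (b - a)" unfolding m(3,4) by (simp add: field_simps)
  finally show ?thesis using assms(1) by (simp add: q m_def)
qed

lemma avg_halves:
  assumes "a < b" "set_integrable lebesgue {a..<b} f"
  shows "avg f {a..<b} = (avg f {a..<(a + b) / 2} + avg f {(a + b) / 2..<b}) / 2"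
proof -
  define m where "m = (a + b) / 2"
  have m: "a < m" "m < b" "m - a = (b - a) / 2" "b - m = (b - a) / 2"
    using assms by (auto simp: m_def field_simps)
  have I: "{a..<b} = {a..<m} \<union> {m..<b}" using m by auto
  have "set_integrable lebesgue {a..<m} f" "set_integrable lebesgue {m..<b} f"
    using set_integrable_subset[OF assms(2)] m by auto
  then have "(LINT t:{a..<b}|lebesgue. f t) = (LINT t:{a..<m}|lebesgue. f t) + (LINT t:{m..<b}|lebesgue. f t)"
    unfolding I by (intro set_integral_Un) auto
  moreover have "(p + q) / L = (p / (L / 2) + q / (L / 2)) / 2" for p q L :: real
    by (simp add: add_divide_distrib)
  moreover have "measure lebesgue {a..<b} = b - a" "measure lebesgue {a..<m} = (b - a) / 2"
    "measure lebesgue {m..<b} = (b - a) / 2"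
    using assms(1) m measure_lebesgue_Ico less_imp_le by metis+
  ultimately show ?thesis
    unfolding avg_def m_def[symmetric] by metis
qed

lemma avg_cong: "c \<le> d \<Longrightarrow> (\<And>t. t \<in> {c..<d} \<Longrightarrow> f t = g t) \<Longrightarrow> avg f {c..<d} = avg g {c..<d}"
  unfolding avg_def by (subst set_lebesgue_integral_cong[of "{c..<d}" lebesgue f g]) auto

lemma avg_nonneg:
  assumes "\<And>t. t \<in> J \<Longrightarrow> 0 \<le> f t"
  shows "0 \<le> avg f J"
  unfolding avg_def set_lebesgue_integral_def using assms
  by (intro divide_nonneg_nonneg Bochner_Integration.integral_nonneg) (auto simp: indicator_def)

section \<open>Level sets and finitely many generations\<close>

text \<open>
  The dyadic operator with arbitrary weights \<open>c J\<close> in place of \<open>\<alpha> J * avg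
  f J powr r\<close>.
\<close>

definition tower :: "(real set \<Rightarrow> real) \<Rightarrow> real set \<Rightarrow> real \<Rightarrow> ennreal" where
  "tower c I t = (\<Sum>\<^sub>\<infinity>J\<in>dyadic I. ennreal (c J * indicator J t))"

lemma tower_outside: "a < b \<Longrightarrow> t \<notin> {a..<b} \<Longrightarrow> tower c {a..<b} t = 0"
  unfolding tower_def by (intro infsum_0) (use dyadic_subset[of a b] in \<open>fastforce simp: indicator_def\<close>)

lemma tower_halves:
  assumes "a < b" "t \<in> {a..<b}"
  shows "tower c {a..<b} t = ennreal (c {a..<b}) +
    (if t < (a + b) / 2 then tower c {a..<(a + b) / 2} t else tower c {(a + b) / 2..<b} t)"
proof -
  have "tower c {a..<b} t =
      ennreal (c {a..<b}) + (tower c {a..<(a + b) / 2} t + tower c {(a + b) / 2..<b} t)"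
    unfolding tower_def using assms by (subst infsum_dyadic_halves) auto
  then show ?thesis
    using tower_outside[of a "(a + b) / 2" t c] tower_outside[of "(a + b) / 2" b t c] assms by auto
qed

text \<open>
  The points of \<open>{a..<b}\<close> at which the weights of the first \<open>n\<close>
  generations already add up to at least \<open>l\<close>. The recursion lowers the level by the
  weight of the current interval, as the Bellman induction requires, and makes the set a finite
  union of intervals.
\<close>

primrec hit :: "(real set \<Rightarrow> real) \<Rightarrow> nat \<Rightarrow> real \<Rightarrow> real \<Rightarrow> real \<Rightarrow> real set" where
  "hit c 0 a b l = (if l \<le> 0 then {a..<b} else {})"
| "hit c (Suc n) a b l =
     hit c n a ((a + b) / 2) (l - c {a..<b}) \<union> hit c n ((a + b) / 2) b (l - c {a..<b})"

lemma hit_subset: "a < b \<Longrightarrow> hit c n a b l \<subseteq> {a..<b}"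
proof (induction n arbitrary: a b l)
  case (Suc n)
  then show ?case using Suc.IH[of a "(a + b) / 2"] Suc.IH[of "(a + b) / 2" b]
    by (fastforce simp: subset_iff)
qed auto

lemma Ico_lmeasurable: "{a..<b} \<in> lmeasurable" for a b :: real
  by (rule bounded_set_imp_lmeasurable) auto

lemma hit_lmeasurable: "a < b \<Longrightarrow> hit c n a b l \<in> lmeasurable"
  by (induction n arbitrary: a b l) (auto intro: Ico_lmeasurable)

lemma measure_hit_le: "a < b \<Longrightarrow> measure lebesgue (hit c n a b l) \<le> b - a"
  using measure_mono_fmeasurable[OF hit_subset[of a b c n l] fmeasurableD[OF hit_lmeasurable] Ico_lmeasurable]
  by simp

lemma measure_hit_Suc:
  assumes "a < b"
  shows "measure lebesgue (hit c (Suc n) a b l) =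
    measure lebesgue (hit c n a ((a + b) / 2) (l - c {a..<b})) +
    measure lebesgue (hit c n ((a + b) / 2) b (l - c {a..<b}))"
proof -
  have "hit c n a ((a + b) / 2) (l - c {a..<b}) \<inter> hit c n ((a + b) / 2) b (l - c {a..<b}) = {}"
    using hit_subset[of a "(a + b) / 2" c n] hit_subset[of "(a + b) / 2" b c n] assms
    by (fastforce simp: subset_iff)
  then show ?thesis using assms by (simp add: measure_Un3 hit_lmeasurable)
qed

lemma hit_cong:
  assumes "a < b" "\<And>J. J \<in> dyadic {a..<b} \<Longrightarrow> c J = c' J"
  shows "hit c n a b l = hit c' n a b l"
  using assms
proof (induction n arbitrary: a b l)
  case (Suc n)
  have d: "dyadic {a..<(a + b) / 2} \<subseteq> dyadic {a..<b}" "dyadic {(a + b) / 2..<b} \<subseteq> dyadic {a..<b}"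
    using dyadic_halves[OF Suc.prems(1)] by auto
  show ?case using Suc.IH[of a "(a + b) / 2"] Suc.IH[of "(a + b) / 2" b] Suc.prems d
    by (auto simp: subset_iff)
qed auto

lemma hit_scale:
  assumes "a < b" "k > 0"
  shows "hit (\<lambda>J. k * c J) n a b (k * l) = hit c n a b l"
  using assms
proof (induction n arbitrary: a b l)
  case 0
  then show ?case by (simp add: mult_le_0_iff)
next
  case (Suc n)
  then show ?case using Suc.IH[of a "(a + b) / 2"] Suc.IH[of "(a + b) / 2" b]
    by (simp flip: right_diff_distrib)
qed

lemma hit_mono:
  assumes "a < b" "\<And>J. J \<in> dyadic {a..<b} \<Longrightarrow> 0 \<le> c J" "n \<le> m"
  shows "hit c n a b l \<subseteq> hit c m a b l"
proof -
  have "hit c n a b l \<subseteq> hit c (Suc n) a b l" for n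
    using assms(1,2)
  proof (induction n arbitrary: a b l)
    case 0
    have "0 \<le> c {a..<b}" using 0 by simp
    then show ?case using 0(1) by auto
  next
    case (Suc n)
    have d: "dyadic {a..<(a + b) / 2} \<subseteq> dyadic {a..<b}" "dyadic {(a + b) / 2..<b} \<subseteq> dyadic {a..<b}"
      using dyadic_halves[OF Suc.prems(1)] by auto
    have "hit c n a ((a + b) / 2) l' \<subseteq> hit c (Suc n) a ((a + b) / 2) l'"
      "hit c n ((a + b) / 2) b l' \<subseteq> hit c (Suc n) ((a + b) / 2) b l'" for l'
      using Suc.IH[of a "(a + b) / 2"] Suc.IH[of "(a + b) / 2" b] Suc.prems d by (auto simp: subset_iff)
    then show ?case by (subst (1 2) hit.simps(2)) blast
  qed
  then show ?thesis using assms(3) by (rule lift_Suc_mono_le)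
qed

lemma hit_imp_tower_ge:
  assumes "a < b" "\<And>J. J \<in> dyadic {a..<b} \<Longrightarrow> 0 \<le> c J" "t \<in> hit c n a b l"
  shows "ennreal l \<le> tower c {a..<b} t"
  using assms
proof (induction n arbitrary: a b l)
  case 0
  then show ?case by (auto split: if_splits simp: ennreal_neg)
next
  case (Suc n)
  define m where "m = (a + b) / 2"
  have m: "a < m" "m < b" using Suc.prems by (auto simp: m_def)
  have d: "dyadic {a..<m} \<subseteq> dyadic {a..<b}" "dyadic {m..<b} \<subseteq> dyadic {a..<b}"
    using dyadic_halves[OF Suc.prems(1)] by (auto simp: m_def)
  have t: "t \<in> {a..<b}" using hit_subset[OF Suc.prems(1)] Suc.prems(3) by blast
  have c0: "0 \<le> c {a..<b}" using Suc.prems by simp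
  have "ennreal (l - c {a..<b}) \<le> (if t < m then tower c {a..<m} t else tower c {m..<b} t)"
  proof (cases "t \<in> hit c n a m (l - c {a..<b})")
    case True
    then have "t < m" using hit_subset[OF m(1)] by fastforce
    then show ?thesis using Suc.IH[OF m(1) _ True] Suc.prems(2) d by (auto simp: subset_iff)
  next
    case False
    then have True: "t \<in> hit c n m b (l - c {a..<b})" using Suc.prems(3) by (simp add: m_def)
    then have "\<not> t < m" using hit_subset[OF m(2)] by fastforce
    then show ?thesis using Suc.IH[OF m(2) _ True] Suc.prems(2) d by (auto simp: subset_iff)
  qed
  then have "ennreal (c {a..<b}) + ennreal (l - c {a..<b}) \<le> tower c {a..<b} t"
    unfolding tower_halves[OF Suc.prems(1) t] m_def[symmetric] by (rule add_left_mono)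
  moreover have "ennreal l \<le> ennreal (c {a..<b}) + ennreal (l - c {a..<b})"
    using c0 by (cases "c {a..<b} \<le> l") (auto simp flip: ennreal_plus simp: ennreal_leI ennreal_neg)
  ultimately show ?case by order
qed

lemma tower_ge_imp_hit:
  assumes "a < b" "\<And>J. J \<in> dyadic {a..<b} \<Longrightarrow> 0 \<le> c J" "t \<in> {a..<b}"
    and "\<And>k J. n \<le> k \<Longrightarrow> J \<in> dyadic_level {a..<b} k \<Longrightarrow> t \<in> J \<Longrightarrow> c J = 0"
    and "ennreal l \<le> tower c {a..<b} t"
  shows "t \<in> hit c n a b l"
  using assms
proof (induction n arbitrary: a b l)
  case 0
  have "tower c {a..<b} t = 0"
    unfolding tower_def using 0(4) by (intro infsum_0) (auto simp: dyadic_def indicator_def)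
  with 0 show ?case by (simp add: ennreal_eq_0_iff)
next
  case (Suc n)
  define m where "m = (a + b) / 2"
  have m: "a < m" "m < b" using Suc.prems by (auto simp: m_def)
  have d: "dyadic {a..<m} \<subseteq> dyadic {a..<b}" "dyadic {m..<b} \<subseteq> dyadic {a..<b}"
    using dyadic_halves[OF Suc.prems(1)] by (auto simp: m_def)
  have lv: "dyadic_level {a..<b} (Suc k) = dyadic_level {a..<m} k \<union> dyadic_level {m..<b} k" for k
    unfolding dyadic_level_Suc_halves m_def using Suc.prems(1)
    by (simp add: left_half_atLeastLessThan right_half_atLeastLessThan)
  have van: "c J = 0" if "n \<le> k" "J \<in> dyadic_level {a..<m} k \<union> dyadic_level {m..<b} k" "t \<in> J" for k J
    using Suc.prems(4)[of "Suc k" J] that by (simp only: lv)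
  have c0: "0 \<le> c {a..<b}" using Suc.prems by simp
  have "ennreal (l - c {a..<b}) \<le> (if t < m then tower c {a..<m} t else tower c {m..<b} t)"
  proof -
    have "ennreal l \<le> ennreal (c {a..<b}) + (if t < m then tower c {a..<m} t else tower c {m..<b} t)"
      using Suc.prems(5) unfolding tower_halves[OF Suc.prems(1,3)] m_def[symmetric] .
    then have "ennreal l - ennreal (c {a..<b}) \<le> (if t < m then tower c {a..<m} t else tower c {m..<b} t)"
      by (subst ennreal_minus_le_iff) (simp add: top_unique)
    then show ?thesis using c0 by (simp only: ennreal_minus)
  qed
  note ge = this
  show ?case
  proof (cases "t < m")
    case True
    have "t \<in> hit c n a m (l - c {a..<b})"
    proof (rule Suc.IH[OF m(1)])
      show "0 \<le> c J" if "J \<in> dyadic {a..<m}" for J using Suc.prems(2) d(1) that by blast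
      show "c J = 0" if "n \<le> k" "J \<in> dyadic_level {a..<m} k" "t \<in> J" for k J
        using van[of k J] that by blast
    qed (use True ge Suc.prems(3) in auto)
    then show ?thesis by (simp add: m_def)
  next
    case False
    have "t \<in> hit c n m b (l - c {a..<b})"
    proof (rule Suc.IH[OF m(2)])
      show "0 \<le> c J" if "J \<in> dyadic {m..<b}" for J using Suc.prems(2) d(2) that by blast
      show "c J = 0" if "n \<le> k" "J \<in> dyadic_level {m..<b} k" "t \<in> J" for k J
        using van[of k J] that by blast
    qed (use False ge Suc.prems(3) in auto)
    then show ?thesis by (simp add: m_def)
  qed
qed

text \<open>
  The measures of the sets covered by the intervals of generation \<open>k\<close> with
  \<open>\<alpha> J = 1\<close> sum up to at most the Carleson mass, which is finite. By
  Borel-Cantelli almost every point lies in only finitely many of these sets.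
\<close>

lemma binary_carleson_AE_finite:
  assumes "a < b" "\<alpha> \<in> binary_carleson {a..<b}"
  shows "AE t in lebesgue. \<exists>n. \<forall>k\<ge>n. \<forall>J\<in>dyadic_level {a..<b} k. t \<in> J \<longrightarrow> \<alpha> J = 0"
proof -
  let ?L = "dyadic_level {a..<b}"
  have bin: "\<alpha> J = 0 \<or> \<alpha> J = 1" if "J \<in> ?L k" for J k
    using assms(2) that unfolding binary_carleson_iff dyadic_def by blast
  have lm: "J \<in> lmeasurable" if "J \<in> ?L k" for J k
    using dyadic_level_interval[OF assms(1) that] Ico_lmeasurable by metis
  define U where "U k = \<Union>{J \<in> ?L k. \<alpha> J = 1}" for k
  define s where "s k = (\<Sum>J\<in>?L k. \<alpha> J * measure lebesgue J)" for k
  have U: "U k \<in> lmeasurable" for k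
    unfolding U_def using lm finite_dyadic_level by (intro fmeasurable.finite_Union) (simp, blast)
  have "measure lebesgue (U k) \<le> s k" for k
  proof -
    have "measure lebesgue (\<Union>J\<in>{J \<in> ?L k. \<alpha> J = 1}. J)
        \<le> (\<Sum>J\<in>{J \<in> ?L k. \<alpha> J = 1}. measure lebesgue J)"
    proof (rule measure_UNION_le)
      show "J \<in> sets lebesgue" if "J \<in> {J \<in> ?L k. \<alpha> J = 1}" for J
        using that fmeasurableD[OF lm] by blast
    qed (simp add: finite_dyadic_level)
    then have "measure lebesgue (U k) \<le> (\<Sum>J\<in>{J \<in> ?L k. \<alpha> J = 1}. measure lebesgue J)"
      by (simp add: U_def)
    also have "\<dots> = s k" unfolding s_def using bin
      by (intro sum.mono_neutral_cong_left) (auto simp: finite_dyadic_level)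
    finally show ?thesis .
  qed
  moreover have "summable s"
  proof (rule bounded_imp_summable)
    show s0: "0 \<le> s k" for k unfolding s_def using bin[of _ k] by (intro sum_nonneg mult_nonneg_nonneg) fastforce+
    fix n
    have disj: "?L i \<inter> ?L j = {}" if "i \<noteq> j" for i j
    proof (rule ccontr)
      assume "\<not> ?thesis"
      then obtain J where J: "J \<in> ?L i" "J \<in> ?L j" by blast
      have len: "measure lebesgue J = (b - a) / 2 ^ k" if "J \<in> ?L k" for k
        using dyadic_level_interval[OF assms(1) that] measure_lebesgue_Ico less_imp_le by metis
      have "(b - a) / 2 ^ i = (b - a) / 2 ^ j" using len[OF J(1)] len[OF J(2)] by (rule trans[OF sym])
      then show False using assms(1) that by simp
    qed
    have "ennreal (sum s {..n}) = (\<Sum>k\<le>n. \<Sum>J\<in>?L k. ennreal (\<alpha> J * measure lebesgue J))"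
    proof -
      have "ennreal (s k) = (\<Sum>J\<in>?L k. ennreal (\<alpha> J * measure lebesgue J))" for k
        unfolding s_def using bin[of _ k]
        by (intro sum_ennreal[symmetric] mult_nonneg_nonneg) fastforce+
      then show ?thesis using s0 by (simp flip: sum_ennreal)
    qed
    also have "\<dots> = (\<Sum>J\<in>(\<Union>k\<le>n. ?L k). ennreal (\<alpha> J * measure lebesgue J))"
      using disj by (intro sum.UNION_disjoint[symmetric]) (auto simp: finite_dyadic_level)
    also have "\<dots> = (\<Sum>\<^sub>\<infinity>J\<in>(\<Union>k\<le>n. ?L k). ennreal (\<alpha> J * measure lebesgue J))"
      by (intro infsum_finite[symmetric]) (auto simp: finite_dyadic_level)
    also have "\<dots> \<le> carleson_mass \<alpha> {a..<b}"
      unfolding carleson_mass_def by (intro infsum_mono_neutral nonneg_summable_on_complete) (auto simp: dyadic_def)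
    also have "\<dots> \<le> ennreal (2 * (b - a))"
      using assms carleson_avg_le_2_iff[OF assms(1), of \<alpha>] by (auto simp: binary_carleson_iff)
    finally show "sum s {..n} \<le> 2 * (b - a)" using assms(1) by (subst (asm) ennreal_le_iff) auto
  qed
  ultimately have "summable (\<lambda>k. measure lebesgue (U k))"
    by - (rule summable_comparison_test'[of s 0], simp_all)
  then have "AE t in lebesgue. eventually (\<lambda>k. t \<in> space lebesgue - U k) sequentially"
  proof (rule borel_cantelli_AE1[OF fmeasurableD[OF U], rotated])
    show "emeasure lebesgue (U k) < \<infinity>" for k
      using fmeasurableD2[OF U, of k] by (simp only: infinity_ennreal_def less_top)
  qed
  then show ?thesis
  proof eventually_elim
    case (elim t)
    then obtain n where n: "\<And>k. n \<le> k \<Longrightarrow> t \<notin> U k"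
      unfolding eventually_sequentially by blast
    have "\<alpha> J = 0" if "n \<le> k" "J \<in> ?L k" "t \<in> J" for k J
      using n[OF that(1)] bin[OF that(2)] that(2,3) unfolding U_def by blast
    then show ?case by blast
  qed
qed

text \<open>
  The sets \<open>hit\<close> increase with the number of generations and are contained in the level
  set. A point of the level set outside their union would meet infinitely many generations with
  \<open>\<alpha> J = 1\<close>, so the difference is a null set. In particular the level set is
  measurable.
\<close>

lemma measure_tower_level_set:
  fixes w :: "real set \<Rightarrow> real" and l :: real
  assumes "a < b" "\<alpha> \<in> binary_carleson {a..<b}" "\<And>J. 0 \<le> w J"
  defines "E \<equiv> {t \<in> {a..<b}. ennreal l \<le> tower (\<lambda>J. \<alpha> J * w J) {a..<b} t}"
  shows "(\<lambda>n. measure lebesgue (hit (\<lambda>J. \<alpha> J * w J) n a b l)) \<longlonglongrightarrow> measure lebesgue E"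
    and "measure lebesgue (hit (\<lambda>J. \<alpha> J * w J) n a b l) \<le> measure lebesgue E"
proof -
  let ?c = "\<lambda>J. \<alpha> J * w J"
  define H where "H n = hit ?c n a b l" for n
  have c0: "0 \<le> ?c J" if "J \<in> dyadic {a..<b}" for J
  proof -
    have "\<alpha> J = 0 \<or> \<alpha> J = 1" using assms(2) that unfolding binary_carleson_iff by blast
    then show ?thesis using assms(3)[of J] by auto
  qed
  have Hm: "H n \<in> lmeasurable" for n unfolding H_def by (rule hit_lmeasurable[OF assms(1)])
  have inc: "incseq H"
    unfolding H_def incseq_def by (intro allI impI hit_mono[OF assms(1) c0])
  have HE: "(\<Union>n. H n) \<subseteq> E"
  proof
    fix t assume "t \<in> (\<Union>n. H n)"
    then obtain n where n: "t \<in> hit ?c n a b l" by (auto simp: H_def)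
    from hit_imp_tower_ge[OF assms(1) c0 n] subsetD[OF hit_subset[OF assms(1)] n]
    show "t \<in> E" by (simp add: E_def)
  qed
  have U: "(\<Union>n. H n) \<in> sets lebesgue" using fmeasurableD[OF Hm] by blast
  have ae: "AE t in lebesgue. t \<in> E \<longleftrightarrow> t \<in> (\<Union>n. H n)"
    using binary_carleson_AE_finite[OF assms(1,2)]
  proof eventually_elim
    case (elim t)
    then obtain n where n: "\<And>k J. n \<le> k \<Longrightarrow> J \<in> dyadic_level {a..<b} k \<Longrightarrow> t \<in> J \<Longrightarrow> \<alpha> J = 0" by blast
    have "t \<in> H n" if "t \<in> E"
      unfolding H_def by (rule tower_ge_imp_hit[OF assms(1) c0]) (use that n in \<open>auto simp: E_def\<close>)
    then show ?case using HE by blast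
  qed
  have E: "E \<in> sets lebesgue"
  proof -
    obtain N where N: "N \<in> null_sets lebesgue" "{t \<in> space lebesgue. \<not> (t \<in> E \<longleftrightarrow> t \<in> (\<Union>n. H n))} \<subseteq> N"
      using ae unfolding eventually_ae_filter by blast
    then have "E - (\<Union>n. H n) \<in> null_sets lebesgue"
      by (intro null_sets_completion_subset[OF _ N(1)]) auto
    from sets.Un[OF U null_setsD2[OF this]]
    have "(\<Union>n. H n) \<union> (E - (\<Union>n. H n)) \<in> sets lebesgue" .
    then show ?thesis using HE by (simp add: Un_absorb1)
  qed
  have fin: "(\<Union>n. H n) \<in> lmeasurable"
  proof (rule bounded_set_imp_lmeasurable[OF bounded_subset U])
    show "(\<Union>n. H n) \<subseteq> {a..<b}" using hit_subset[OF assms(1)] unfolding H_def by blast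
  qed simp
  have eq: "measure lebesgue E = measure lebesgue (\<Union>n. H n)"
    using ae E U by (rule measure_eq_AE)
  show lim: "(\<lambda>n. measure lebesgue (hit ?c n a b l)) \<longlonglongrightarrow> measure lebesgue E"
    unfolding eq H_def[symmetric]
  proof (rule Lim_measure_incseq[OF _ inc])
    show "range H \<subseteq> sets lebesgue" using fmeasurableD[OF Hm] by blast
    show "emeasure lebesgue (\<Union>n. H n) \<noteq> \<infinity>" using fmeasurableD2[OF fin] by simp
  qed
  show "measure lebesgue (hit ?c n a b l) \<le> measure lebesgue E"
    unfolding eq H_def[symmetric] using fin by (intro measure_mono_fmeasurable fmeasurableD[OF Hm]) blast+
qed

section \<open>The upper bound\<close>

text \<open>
  Bellman induction on the number of generations: for the two halves the bound holds at the lowered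
  level; midpoint concavity combines them, and if \<open>\<alpha>\<close> is \<open>1\<close> on the
  whole interval the inequality along jumps absorbs the change of \<open>A\<close> and of the level.
\<close>

lemma measure_hit_le_potential:
  assumes "r > 0" "a < b" "set_integrable lebesgue {a..<b} f" "\<And>t. t \<in> {a..<b} \<Longrightarrow> 0 \<le> f t"
    and "\<alpha> \<in> binary_carleson {a..<b}"
  shows "measure lebesgue (hit (\<lambda>J. \<alpha> J * avg f J powr r) n a b l)
    \<le> (b - a) * potential r (avg f {a..<b}) (carleson_real \<alpha> {a..<b}) l"
  using assms(2-)
proof (induction n arbitrary: a b l)
  case 0
  have "0 \<le> potential r (avg f {a..<b}) (carleson_real \<alpha> {a..<b}) l"
    using carleson_real[OF 0(4)] assms(1) 0(3) by (intro potential_nonneg avg_nonneg) auto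
  then show ?case using 0(1) by (auto simp: potential_def)
next
  case (Suc n)
  define m where "m = (a + b) / 2"
  have m: "a < m" "m < b" "m - a = (b - a) / 2" "b - m = (b - a) / 2"
    using Suc.prems(1) by (auto simp: m_def field_simps)
  note bc = binary_carleson_halves[OF Suc.prems(1,4), folded m_def]
  define x x1 x2 where x: "x = avg f {a..<b}" "x1 = avg f {a..<m}" "x2 = avg f {m..<b}"
  define A A1 A2 where A: "A = carleson_real \<alpha> {a..<b}" "A1 = carleson_real \<alpha> {a..<m}"
    "A2 = carleson_real \<alpha> {m..<b}"
  define l' where "l' = l - \<alpha> {a..<b} * x powr r"
  have nn: "0 \<le> x1" "0 \<le> x2" "0 \<le> A1" "0 \<le> A2"
    using carleson_real[OF bc(1)] carleson_real[OF bc(2)] Suc.prems(3) m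
    by (auto simp: x A intro!: avg_nonneg)
  have xm: "x = (x1 + x2) / 2"
    unfolding x m_def by (rule avg_halves[OF Suc.prems(1,2)])
  then have x0: "0 \<le> x" using nn by simp
  have Am: "A = \<alpha> {a..<b} + (A1 + A2) / 2"
    unfolding A m_def by (rule carleson_real_halves[OF Suc.prems(1,4)])
  have jump: "potential r x ((A1 + A2) / 2) l' \<le> potential r x A l"
  proof -
    have "\<alpha> {a..<b} = 0 \<or> \<alpha> {a..<b} = 1"
      using Suc.prems(4) dyadic_self[of "{a..<b}"] unfolding binary_carleson_iff by blast
    then show ?thesis
    proof
      assume "\<alpha> {a..<b} = 1"
      moreover have "A \<le> 2" unfolding A by (rule carleson_real(3)[OF Suc.prems(4)])
      ultimately show ?thesis
        using potential_jump[of r x "(A1 + A2) / 2" l] nn assms(1) x0 by (simp add: l'_def Am)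
    qed (simp add: l'_def Am)
  qed
  have int: "set_integrable lebesgue {a..<m} f" "set_integrable lebesgue {m..<b} f"
    using set_integrable_subset[OF Suc.prems(2)] m by auto
  let ?h = "hit (\<lambda>J. \<alpha> J * avg f J powr r)"
  have "measure lebesgue (?h n a m l') \<le> (m - a) * potential r x1 A1 l'"
    unfolding x A using Suc.prems(3) m by (intro Suc.IH int bc) auto
  moreover have "measure lebesgue (?h n m b l') \<le> (b - m) * potential r x2 A2 l'"
    unfolding x A using Suc.prems(3) m by (intro Suc.IH int bc) auto
  moreover have "measure lebesgue (?h (Suc n) a b l) =
      measure lebesgue (?h n a m l') + measure lebesgue (?h n m b l')"
    using measure_hit_Suc[OF Suc.prems(1)] by (simp add: l'_def x m_def)
  ultimately have "measure lebesgue (?h (Suc n) a b l) \<le> (b - a) * ((potential r x1 A1 l' + potential r x2 A2 l') / 2)"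
    unfolding m(3,4) by (simp add: distrib_left)
  also have "\<dots> \<le> (b - a) * potential r x A l"
    using potential_midpoint[of r x1 A1 x2 A2 l'] nn assms(1) jump Suc.prems(1)
    by (intro mult_left_mono) (simp_all add: xm)
  finally show ?case unfolding x A .
qed

section \<open>Values attained by gluing\<close>

text \<open>
  With \<open>F k = \<lfloor>A 2\<^sup>k\<rfloor>\<close> the digits are \<open>F (k + 1) - 2 F
  k\<close>, and the series telescopes to the limit of \<open>F k / 2\<^sup>k\<close>.
\<close>

lemma binary_digits:
  fixes A :: real
  assumes "0 \<le> A" "A < 1"
  obtains d :: "nat \<Rightarrow> real" where "\<And>k. d k \<in> {0, 1}" "(\<lambda>k. d k / 2 ^ Suc k) sums A"
proof -
  define F where "F k = real_of_int \<lfloor>A * 2 ^ k\<rfloor>" for k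
  define d where "d k = F (Suc k) - 2 * F k" for k
  have "d k \<in> {0, 1}" for k
  proof -
    define i where "i = \<lfloor>A * 2 ^ Suc k\<rfloor> - 2 * \<lfloor>A * 2 ^ k\<rfloor>"
    have "real_of_int i < 2" "- 1 < real_of_int i" unfolding i_def by (simp_all, linarith+)
    then have "i = 0 \<or> i = 1" by linarith
    moreover have "d k = real_of_int i" by (simp add: d_def F_def i_def)
    ultimately show ?thesis by auto
  qed
  moreover have "(\<lambda>k. d k / 2 ^ Suc k) sums A"
  proof -
    have lim: "(\<lambda>k. F k / 2 ^ k) \<longlonglongrightarrow> A"
    proof (rule tendsto_sandwich)
      have "(\<lambda>k. A - (1 / 2) ^ k) \<longlonglongrightarrow> A - 0"
        by (intro tendsto_diff tendsto_const LIMSEQ_power_zero) auto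
      then show "(\<lambda>k. A - (1 / 2) ^ k) \<longlonglongrightarrow> A" by simp
      have "A - (1 / 2) ^ k \<le> F k / 2 ^ k" for k
      proof -
        have "A * 2 ^ k - 1 \<le> F k" unfolding F_def by linarith
        then have "(A * 2 ^ k - 1) / 2 ^ k \<le> F k / 2 ^ k" by (rule divide_right_mono) simp
        then show ?thesis by (simp add: diff_divide_distrib power_one_over)
      qed
      then show "\<forall>\<^sub>F k in sequentially. A - (1 / 2) ^ k \<le> F k / 2 ^ k" by simp
      have "F k / 2 ^ k \<le> A" for k
        unfolding F_def by (simp add: divide_le_eq)
      then show "\<forall>\<^sub>F k in sequentially. F k / 2 ^ k \<le> A" by simp
    qed auto
    have "\<lfloor>A\<rfloor> = 0" using assms by (simp add: floor_eq_iff)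
    then have "F 0 = 0" by (simp add: F_def)
    moreover have "d k / 2 ^ Suc k = F (Suc k) / 2 ^ Suc k - F k / 2 ^ k" for k
      by (simp add: d_def diff_divide_distrib)
    ultimately show ?thesis using telescope_sums[OF lim] by simp
  qed
  ultimately show ?thesis using that by blast
qed

lemma infsum_nat_eq_suminf:
  fixes g :: "nat \<Rightarrow> ennreal"
  shows "infsum g UNIV = suminf g"
proof -
  have "(g has_sum infsum g UNIV) UNIV"
    by (intro has_sum_infsum nonneg_summable_on_complete) auto
  then show ?thesis by (metis has_sum_imp_sums sums_unique)
qed

text \<open>
  The intervals that fill \<open>{a..<b}\<close> from the left, \<open>J k\<close> being the left
  half of what remains after \<open>J 0, \<dots>, J (k - 1)\<close>, are disjoint and have relative
  lengths \<open>1/2, 1/4, \<dots>\<close>. Selecting those whose binary digit of \<open>A\<close>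
  is \<open>1\<close> gives mass \<open>A\<close>, and disjointness keeps every average at most
  \<open>1\<close>.
\<close>

lemma carleson_sequence_exists_less_1:
  assumes "a < b" "0 \<le> A" "A < 1"
  shows "\<exists>\<alpha>\<in>binary_carleson {a..<b}. carleson_avg \<alpha> {a..<b} = ennreal A"
proof -
  obtain d :: "nat \<Rightarrow> real" where d: "\<And>k. d k \<in> {0, 1}" "(\<lambda>k. d k / 2 ^ Suc k) sums A"
    using binary_digits[OF assms(2,3)] by blast
  define p where "p k = b - (b - a) / 2 ^ k" for k :: nat
  define J where "J k = {p k..<p (Suc k)}" for k
  have p_less: "p k < p (Suc k)" for k using assms(1) by (simp add: p_def field_simps)
  have pb: "p k < b" for k using assms(1) by (simp add: p_def)
  have mJ: "measure lebesgue (J k) = (b - a) / 2 ^ Suc k" for k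
    using p_less[of k] measure_lebesgue_Ico[of "p k" "p (Suc k)"] by (simp add: J_def) (simp add: p_def field_simps)
  have mid: "(p k + b) / 2 = p (Suc k)" for k by (simp add: p_def field_simps)
  have right: "{p k..<b} \<in> dyadic_level {a..<b} k" for k
  proof (induction k)
    case (Suc k)
    have "right_half {p k..<b} = {p (Suc k)..<b}"
      using right_half_atLeastLessThan[OF pb[of k]] by (simp only: mid)
    then show ?case using Suc by force
  qed (simp add: p_def)
  have JD: "J k \<in> dyadic {a..<b}" for k
  proof -
    have "left_half {p k..<b} = J k"
      using left_half_atLeastLessThan[OF pb[of k]] by (simp only: mid J_def)
    then have "J k \<in> dyadic_level {a..<b} (Suc k)" using right[of k] by force
    then show ?thesis unfolding dyadic_def by blast
  qed
  have p_mono: "p i \<le> p j" if "i \<le> j" for i j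
    using that by (rule lift_Suc_mono_le[of p, OF less_imp_le[OF p_less]])
  have disj: "disjoint_family J"
  proof -
    have "J i \<inter> J j = {}" if "i < j" for i j
      using p_mono[of "Suc i" j] that by (auto simp: J_def)
    then show ?thesis unfolding disjoint_family_on_def by (metis Int_commute linorder_neqE_nat)
  qed
  have inj: "inj J"
  proof (rule injI)
    fix i j assume "J i = J j"
    moreover have "p i \<in> J i" using p_less by (simp add: J_def)
    ultimately show "i = j" using disj by (auto simp: disjoint_family_on_def)
  qed
  define \<alpha> where "\<alpha> K = (if \<exists>k. d k = 1 \<and> K = J k then 1 else 0 :: real)" for K
  have \<alpha>J: "\<alpha> (J k) = d k" for k
    using d(1)[of k] inj by (auto simp: \<alpha>_def dest: injD)
  have mass: "carleson_mass \<alpha> L = (\<Sum>k. if J k \<in> dyadic L then ennreal (d k * measure lebesgue (J k)) else 0)" for L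
  proof -
    have "carleson_mass \<alpha> L = (\<Sum>\<^sub>\<infinity>K\<in>range J. if K \<in> dyadic L then ennreal (\<alpha> K * measure lebesgue K) else 0)"
      unfolding carleson_mass_def by (intro infsum_cong_neutral) (auto simp: \<alpha>_def)
    also have "\<dots> = (\<Sum>\<^sub>\<infinity>k. if J k \<in> dyadic L then ennreal (\<alpha> (J k) * measure lebesgue (J k)) else 0)"
      using infsum_reindex[OF inj] by (simp add: o_def)
    finally show ?thesis unfolding \<alpha>J infsum_nat_eq_suminf .
  qed
  have "carleson_mass \<alpha> {a..<b} = (\<Sum>k. ennreal (d k * measure lebesgue (J k)))"
    unfolding mass using JD by simp
  also have "\<dots> = ennreal (A * (b - a))"
  proof -
    have s: "(\<lambda>k. d k * measure lebesgue (J k)) sums (A * (b - a))"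
      using sums_mult2[OF d(2), of "b - a"] by (simp add: mJ)
    have "0 \<le> d k" for k using d(1)[of k] by auto
    then have "(\<Sum>k. ennreal (d k * measure lebesgue (J k))) = ennreal (\<Sum>k. d k * measure lebesgue (J k))"
      using s by (intro suminf_ennreal2) (auto simp: sums_iff)
    then show ?thesis using s by (simp add: sums_iff)
  qed
  finally have A: "carleson_avg \<alpha> {a..<b} = ennreal A"
    using carleson_avg_eq_iff[OF assms(1,2)] by simp
  have "carleson_avg \<alpha> L \<le> 2" if L: "L \<in> dyadic {a..<b}" for L
  proof -
    obtain u v where uv: "L = {u..<v}" "u < v" using dyadic_interval[OF assms(1) L] by blast
    define B where "B k = (if J k \<in> dyadic L then J k else {})" for k
    have BL: "B k \<subseteq> L" for k using dyadic_subset[OF uv(2)] by (auto simp: B_def uv(1))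
    have "carleson_mass \<alpha> L \<le> (\<Sum>k. emeasure lebesgue (B k))"
      unfolding mass
    proof (intro suminf_le)
      show "(if J k \<in> dyadic L then ennreal (d k * measure lebesgue (J k)) else 0) \<le> emeasure lebesgue (B k)" for k
        using d(1)[of k] p_less[of k] by (auto simp: B_def J_def)
    qed auto
    also have "\<dots> = emeasure lebesgue (\<Union>k. B k)"
    proof (rule suminf_emeasure)
      show "range B \<subseteq> sets lebesgue" by (auto simp: B_def J_def)
      show "disjoint_family B" using disj by (auto simp: disjoint_family_on_def B_def)
    qed
    also have "\<dots> \<le> emeasure lebesgue L" using BL uv by (intro emeasure_mono) auto
    also have "\<dots> = ennreal (v - u)" using uv by simp
    also have "\<dots> \<le> ennreal (2 * (v - u))" using uv by (intro ennreal_leI) simp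
    finally show ?thesis using uv carleson_avg_le_2_iff by simp
  qed
  then have "\<alpha> \<in> binary_carleson {a..<b}" by (auto simp: binary_carleson_iff \<alpha>_def)
  with A show ?thesis by blast
qed

definition admissible :: "real \<Rightarrow> real \<Rightarrow> real \<Rightarrow> real \<Rightarrow> (real \<Rightarrow> real) \<Rightarrow> (real set \<Rightarrow> real) \<Rightarrow> bool" where
  "admissible a b x A f \<alpha> \<longleftrightarrow>
     set_integrable lebesgue {a..<b} f \<and> (\<forall>t\<in>{a..<b}. 0 \<le> f t) \<and> avg f {a..<b} = x \<and>
     \<alpha> \<in> binary_carleson {a..<b} \<and> carleson_avg \<alpha> {a..<b} = ennreal A"

lemma admissibleD:
  assumes "admissible a b x A f \<alpha>"
  shows "set_integrable lebesgue {a..<b} f" "\<And>t. t \<in> {a..<b} \<Longrightarrow> 0 \<le> f t" "avg f {a..<b} = x"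
    "\<alpha> \<in> binary_carleson {a..<b}" "carleson_avg \<alpha> {a..<b} = ennreal A"
  using assms by (simp_all add: admissible_def)

text \<open>
  The value \<open>v\<close> is required on every interval at once, so that competitors for the two
  halves of an interval are at hand without any affine change of variables. Finitely many
  generations suffice and make measurability of the level sets immaterial.
\<close>

definition attainable :: "real \<Rightarrow> real \<Rightarrow> real \<Rightarrow> real \<Rightarrow> real \<Rightarrow> bool" where
  "attainable r x A l v \<longleftrightarrow> (\<forall>a b. a < b \<longrightarrow> (\<exists>f \<alpha> n. admissible a b x A f \<alpha> \<and>
     v * (b - a) \<le> measure lebesgue (hit (\<lambda>J. \<alpha> J * avg f J powr r) n a b l)))"

lemma attainableE:
  assumes "attainable r x A l v" "a < b"
  obtains f \<alpha> n where "admissible a b x A f \<alpha>"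
    "v * (b - a) \<le> measure lebesgue (hit (\<lambda>J. \<alpha> J * avg f J powr r) n a b l)"
  using assms unfolding attainable_def by blast

lemma attainable_le_1:
  assumes "attainable r x A l v"
  shows "v \<le> 1"
proof -
  obtain f \<alpha> n where
    "v * (1 - 0) \<le> measure lebesgue (hit (\<lambda>J. \<alpha> J * avg f J powr r) n 0 1 l)"
    using attainableE[OF assms zero_less_one] by blast
  also have "\<dots> \<le> 1 - 0" by (rule measure_hit_le) simp
  finally show ?thesis by simp
qed

lemma attainable_weaken:
  assumes "attainable r x A l v" "u \<le> v"
  shows "attainable r x A l u"
  unfolding attainable_def
proof (intro allI impI)
  fix a b :: real assume ab: "a < b"
  then have uv: "u * (b - a) \<le> v * (b - a)" using assms(2) by (intro mult_right_mono) auto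
  obtain f \<alpha> n where f: "admissible a b x A f \<alpha>"
     "v * (b - a) \<le> measure lebesgue (hit (\<lambda>J. \<alpha> J * avg f J powr r) n a b l)"
    using attainableE[OF assms(1) ab] .
  from f(1) order_trans[OF uv f(2)] show "\<exists>f \<alpha> n. admissible a b x A f \<alpha> \<and>
      u * (b - a) \<le> measure lebesgue (hit (\<lambda>J. \<alpha> J * avg f J powr r) n a b l)" by blast
qed

text \<open>
  Let \<open>f\<close> and \<open>\<alpha>\<close> agree with the given competitors on the halves
  and let \<open>\<alpha>\<close> be \<open>e\<close> on the whole interval. The average of
  \<open>f\<close> there is \<open>(x\<^sub>1 + x\<^sub>2) / 2\<close>, so \<open>e\<close> lowers
  the level for both halves by \<open>e\<close> times its \<open>r\<close>-th power. For \<open>e =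
  0\<close> this is a split, for \<open>e = 1\<close> with equal halves a jump.
\<close>

lemma attainable_glue:
  assumes "attainable r x1 A1 (l - e * ((x1 + x2) / 2) powr r) v1"
    "attainable r x2 A2 (l - e * ((x1 + x2) / 2) powr r) v2"
    and "e \<in> {0, 1}" "0 \<le> A1" "0 \<le> A2" "e + (A1 + A2) / 2 \<le> 2"
  shows "attainable r ((x1 + x2) / 2) (e + (A1 + A2) / 2) l ((v1 + v2) / 2)"
  unfolding attainable_def
proof (intro allI impI)
  fix a b :: real assume ab: "a < b"
  define m where "m = (a + b) / 2"
  have m: "a < m" "m < b" "m - a = (b - a) / 2" "b - m = (b - a) / 2"
    using ab by (auto simp: m_def field_simps)
  define l' where "l' = l - e * ((x1 + x2) / 2) powr r"
  obtain f1 \<alpha>1 n1 where adm1: "admissible a m x1 A1 f1 \<alpha>1"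
    and h1: "v1 * (m - a) \<le> measure lebesgue (hit (\<lambda>J. \<alpha>1 J * avg f1 J powr r) n1 a m l')"
    using attainableE[OF assms(1)[folded l'_def] m(1)] .
  obtain f2 \<alpha>2 n2 where adm2: "admissible m b x2 A2 f2 \<alpha>2"
    and h2: "v2 * (b - m) \<le> measure lebesgue (hit (\<lambda>J. \<alpha>2 J * avg f2 J powr r) n2 m b l')"
    using attainableE[OF assms(2)[folded l'_def] m(2)] .
  note 1 = admissibleD[OF adm1] h1
  note 2 = admissibleD[OF adm2] h2
  note D = dyadic_halves[OF ab, folded m_def]
  define f where "f t = (if t < m then f1 t else f2 t)" for t
  define \<alpha> where "\<alpha> J = (if J = {a..<b} then e else if J \<subseteq> {a..<m} then \<alpha>1 J else \<alpha>2 J)" for J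
  have \<alpha>1: "\<alpha> J = \<alpha>1 J" if "J \<in> dyadic {a..<m}" for J
    using dyadic_subset[OF m(1) that] dyadic_halves_disjoint(2)[OF ab, folded m_def] that
    by (auto simp: \<alpha>_def)
  have \<alpha>2: "\<alpha> J = \<alpha>2 J" if J: "J \<in> dyadic {m..<b}" for J
  proof -
    obtain c d where cd: "J = {c..<d}" "c < d" "m \<le> c" using dyadic_interval[OF m(2) J] by blast
    then have "c \<in> J" "c \<notin> {a..<m}" by auto
    then have "\<not> J \<subseteq> {a..<m}" by blast
    then show ?thesis using dyadic_halves_disjoint(3)[OF ab, folded m_def] that by (auto simp: \<alpha>_def)
  qed
  have f1: "avg f J = avg f1 J" if J: "J \<in> dyadic {a..<m}" for J
  proof -
    obtain c d where cd: "J = {c..<d}" "c < d" "d \<le> m" using dyadic_interval[OF m(1) J] by blast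
    then show ?thesis by (auto intro!: avg_cong simp: f_def)
  qed
  have f2: "avg f J = avg f2 J" if J: "J \<in> dyadic {m..<b}" for J
  proof -
    obtain c d where cd: "J = {c..<d}" "c < d" "m \<le> c" using dyadic_interval[OF m(2) J] by blast
    then show ?thesis by (auto intro!: avg_cong simp: f_def)
  qed
  have I: "{a..<b} = {a..<m} \<union> {m..<b}" using m by auto
  have int: "set_integrable lebesgue {a..<b} f"
  proof -
    have "set_integrable lebesgue {a..<m} f"
      using 1(1) by (subst set_integrable_cong[where f' = f1]) (auto simp: f_def)
    moreover have "set_integrable lebesgue {m..<b} f"
      using 2(1) by (subst set_integrable_cong[where f' = f2]) (auto simp: f_def)
    ultimately show ?thesis unfolding I by (intro set_integrable_Un) auto
  qed
  have x: "avg f {a..<b} = (x1 + x2) / 2"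
    using avg_halves[OF ab int, folded m_def] f1[of "{a..<m}"] f2[of "{m..<b}"] 1(3) 2(3) by simp
  have e: "0 \<le> e" using assms(3) by auto
  have mass: "carleson_mass \<alpha> {a..<b} = ennreal ((e + (A1 + A2) / 2) * (b - a))"
  proof -
    have "carleson_mass \<alpha> {a..<m} = ennreal (A1 * (m - a))"
      using 1(5) carleson_avg_eq_iff[OF m(1) assms(4), of \<alpha>1] carleson_mass_cong[of "{a..<m}" \<alpha> \<alpha>1] \<alpha>1 by simp
    moreover have "carleson_mass \<alpha> {m..<b} = ennreal (A2 * (b - m))"
      using 2(5) carleson_avg_eq_iff[OF m(2) assms(5), of \<alpha>2] carleson_mass_cong[of "{m..<b}" \<alpha> \<alpha>2] \<alpha>2 by simp
    moreover have "\<alpha> {a..<b} = e" by (simp add: \<alpha>_def)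
    ultimately have "carleson_mass \<alpha> {a..<b} = ennreal (e * (b - a)) + (ennreal (A1 * (m - a)) + ennreal (A2 * (b - m)))"
      using carleson_mass_halves[OF ab, of \<alpha>, folded m_def] by simp
    also have "\<dots> = ennreal (e * (b - a) + (A1 * (m - a) + A2 * (b - m)))"
      using e assms(4,5) m(1,2) ab by (simp flip: ennreal_plus)
    also have "e * (b - a) + (A1 * (m - a) + A2 * (b - m)) = (e + (A1 + A2) / 2) * (b - a)"
      unfolding m(3,4) by (simp add: field_simps)
    finally show ?thesis .
  qed
  then have A: "carleson_avg \<alpha> {a..<b} = ennreal (e + (A1 + A2) / 2)"
    using e assms(4,5) by (subst carleson_avg_eq_iff[OF ab]) auto
  have bc: "\<alpha> \<in> binary_carleson {a..<b}"
    unfolding binary_carleson_iff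
  proof
    fix J assume "J \<in> dyadic {a..<b}"
    then consider "J = {a..<b}" | "J \<in> dyadic {a..<m}" | "J \<in> dyadic {m..<b}" using D by blast
    then show "\<alpha> J \<in> {0, 1} \<and> carleson_avg \<alpha> J \<le> 2"
    proof cases
      case 1
      have "ennreal (e + (A1 + A2) / 2) \<le> ennreal 2" using assms(6) by (rule ennreal_leI)
      then show ?thesis using 1 A assms(3) by (simp add: \<alpha>_def)
    next
      case 2
      have "carleson_avg \<alpha> J = carleson_avg \<alpha>1 J"
        using carleson_mass_cong[of J \<alpha> \<alpha>1] \<alpha>1 dyadic_trans[OF 2]
        by (simp add: carleson_avg_def carleson_mass_def[symmetric] subset_iff)
      then show ?thesis using 1(4) 2 \<alpha>1[OF 2] unfolding binary_carleson_iff by simp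
    next
      case 3
      have "carleson_avg \<alpha> J = carleson_avg \<alpha>2 J"
        using carleson_mass_cong[of J \<alpha> \<alpha>2] \<alpha>2 dyadic_trans[OF 3]
        by (simp add: carleson_avg_def carleson_mass_def[symmetric] subset_iff)
      then show ?thesis using 2(4) 3 \<alpha>2[OF 3] unfolding binary_carleson_iff by simp
    qed
  qed
  \<comment> \<open>The two competitors may need different numbers of generations; \<open>hit\<close> increases with that number.\<close>
  define n where "n = max n1 n2"
  let ?c = "\<lambda>J. \<alpha> J * avg f J powr r"
  have c0: "0 \<le> ?c J" if "J \<in> dyadic {a..<b}" for J
  proof -
    have "\<alpha> J = 0 \<or> \<alpha> J = 1" using bc that unfolding binary_carleson_iff by blast
    then show ?thesis by auto
  qed
  have "v1 * (m - a) \<le> measure lebesgue (hit ?c n a m l')"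
  proof -
    have "hit (\<lambda>J. \<alpha>1 J * avg f1 J powr r) n1 a m l' = hit ?c n1 a m l'"
      using \<alpha>1 f1 by (intro hit_cong[OF m(1)]) simp
    also have "\<dots> \<subseteq> hit ?c n a m l'"
      using c0 D by (intro hit_mono[OF m(1)]) (auto simp: n_def)
    finally have "measure lebesgue (hit (\<lambda>J. \<alpha>1 J * avg f1 J powr r) n1 a m l') \<le> measure lebesgue (hit ?c n a m l')"
      by (rule measure_mono_fmeasurable[OF _ fmeasurableD]) (rule hit_lmeasurable[OF m(1)])+
    with 1(6) show ?thesis by simp
  qed
  moreover have "v2 * (b - m) \<le> measure lebesgue (hit ?c n m b l')"
  proof -
    have "hit (\<lambda>J. \<alpha>2 J * avg f2 J powr r) n2 m b l' = hit ?c n2 m b l'"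
      using \<alpha>2 f2 by (intro hit_cong[OF m(2)]) simp
    also have "\<dots> \<subseteq> hit ?c n m b l'"
      using c0 D by (intro hit_mono[OF m(2)]) (auto simp: n_def)
    finally have "measure lebesgue (hit (\<lambda>J. \<alpha>2 J * avg f2 J powr r) n2 m b l') \<le> measure lebesgue (hit ?c n m b l')"
      by (rule measure_mono_fmeasurable[OF _ fmeasurableD]) (rule hit_lmeasurable[OF m(2)])+
    with 2(6) show ?thesis by simp
  qed
  moreover have "measure lebesgue (hit ?c (Suc n) a b l) =
      measure lebesgue (hit ?c n a m l') + measure lebesgue (hit ?c n m b l')"
  proof -
    have "\<alpha> {a..<b} = e" by (simp add: \<alpha>_def)
    then show ?thesis using measure_hit_Suc[OF ab, of ?c n l] by (simp only: x l'_def m_def)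
  qed
  ultimately have "(v1 + v2) / 2 * (b - a) \<le> measure lebesgue (hit ?c (Suc n) a b l)"
    unfolding m(3,4) by (simp add: distrib_right add_divide_distrib)
  moreover have "admissible a b ((x1 + x2) / 2) (e + (A1 + A2) / 2) f \<alpha>"
    using int x bc A 1(2) 2(2) by (auto simp: admissible_def f_def)
  ultimately show "\<exists>f \<alpha> n. admissible a b ((x1 + x2) / 2) (e + (A1 + A2) / 2) f \<alpha> \<and>
      (v1 + v2) / 2 * (b - a) \<le> measure lebesgue (hit (\<lambda>J. \<alpha> J * avg f J powr r) n a b l)"
    by blast
qed

lemma attainable_jump:
  assumes "attainable r x B (l - x powr r) v" "0 \<le> B" "B \<le> 1"
  shows "attainable r x (1 + B) l v"
  using attainable_glue[of r x B l 1 x v B v] assms by simp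

lemma attainable_midpoint:
  assumes "attainable r x1 A1 l v1" "attainable r x2 A2 l v2" "A1 \<in> {0..2}" "A2 \<in> {0..2}"
  shows "attainable r ((x1 + x2) / 2) ((A1 + A2) / 2) l ((v1 + v2) / 2)"
  using attainable_glue[of r x1 A1 l 0 x2 v1 A2 v2] assms by simp

text \<open>
  A constant \<open>f\<close> with a suitable sequence \<open>\<alpha>\<close>. Values \<open>A
  \<ge> 1\<close> are reduced by jumps, which do not raise the level; the endpoint \<open>A =
  2\<close> takes two of them.
\<close>

lemma attainable_trivial:
  assumes "x \<ge> 0" "0 \<le> A" "A \<le> 2"
  shows "attainable r x A l (if l \<le> 0 then 1 else 0)"
proof -
  have lt1: "attainable r x A l (if l \<le> 0 then 1 else 0)" if A: "0 \<le> A" "A < 1" for A l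
    unfolding attainable_def
  proof (intro allI impI)
    fix a b :: real assume ab: "a < b"
    obtain \<alpha> where "\<alpha> \<in> binary_carleson {a..<b}" "carleson_avg \<alpha> {a..<b} = ennreal A"
      using carleson_sequence_exists_less_1[OF ab A] by blast
    moreover have "set_integrable lebesgue {a..<b} (\<lambda>_. x)"
      using Ico_lmeasurable[of a b] unfolding set_integrable_def
      by (intro integrable_scaleR_left) (simp add: lmeasurable_iff_integrable)
    moreover have "avg (\<lambda>_. x) {a..<b} = x"
      using ab by (simp add: avg_def set_integral_const)
    ultimately have "admissible a b x A (\<lambda>_. x) \<alpha>"
      using assms(1) by (simp add: admissible_def)
    moreover have "(if l \<le> 0 then 1 else 0) * (b - a) \<le> measure lebesgue (hit c 0 a b l)" for c
      using ab by simp
    ultimately show "\<exists>f \<alpha> n. admissible a b x A f \<alpha> \<and>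
      (if l \<le> 0 then 1 else 0) * (b - a) \<le> measure lebesgue (hit (\<lambda>J. \<alpha> J * avg f J powr r) n a b l)"
      by blast
  qed
  have step: "attainable r x (1 + B) l (if l \<le> 0 then 1 else 0)"
    if B: "0 \<le> B" "B \<le> 1" and att: "\<And>l. attainable r x B l (if l \<le> 0 then 1 else 0)" for B l
  proof -
    have "l - x powr r \<le> 0" if "l \<le> 0" using that powr_ge_zero[of x r] by linarith
    then have "attainable r x B (l - x powr r) (if l \<le> 0 then 1 else 0)"
      by (intro attainable_weaken[OF att]) auto
    then show ?thesis using B by (rule attainable_jump)
  qed
  \<comment> \<open>The binary digits only cover \<open>A < 1\<close>; the value \<open>1\<close> is a jump from \<open>0\<close>.\<close>
  have eq1: "attainable r x 1 l (if l \<le> 0 then 1 else 0)" for l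
    using step[of 0 l] lt1[of 0] by simp
  consider "A < 1" | "1 \<le> A" "A < 2" | "A = 2" using assms(3) by linarith
  then show ?thesis
  proof cases
    case 1 then show ?thesis using lt1 assms by simp
  next
    case 2 then show ?thesis using step[of "A - 1" l] lt1[of "A - 1"] by simp
  next
    case 3 then show ?thesis using step[of 1 l] eq1 by simp
  qed
qed

lemma attainable_scale:
  assumes "attainable r x A l v" "k > 0"
  shows "attainable r (k * x) A (k powr r * l) v"
  unfolding attainable_def
proof (intro allI impI)
  fix a b :: real assume ab: "a < b"
  obtain f \<alpha> n where adm: "admissible a b x A f \<alpha>"
    and h: "v * (b - a) \<le> measure lebesgue (hit (\<lambda>J. \<alpha> J * avg f J powr r) n a b l)"
    using attainableE[OF assms(1) ab] .
  note f = admissibleD[OF adm] h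
  have avg: "avg (\<lambda>t. k * f t) J = k * avg f J" for J by (simp add: avg_def)
  have "hit (\<lambda>J. \<alpha> J * avg (\<lambda>t. k * f t) J powr r) n a b (k powr r * l)
      = hit (\<lambda>J. k powr r * (\<alpha> J * avg f J powr r)) n a b (k powr r * l)"
  proof (rule hit_cong[OF ab])
    fix J assume J: "J \<in> dyadic {a..<b}"
    have "0 \<le> avg f J" using f(2) dyadic_subset[OF ab J] by (intro avg_nonneg) blast
    then show "\<alpha> J * avg (\<lambda>t. k * f t) J powr r = k powr r * (\<alpha> J * avg f J powr r)"
      using assms(2) by (simp add: avg powr_mult)
  qed
  also have "\<dots> = hit (\<lambda>J. \<alpha> J * avg f J powr r) n a b l"
    using assms(2) by (intro hit_scale[OF ab]) simp
  finally have h: "v * (b - a) \<le> measure lebesgue (hit (\<lambda>J. \<alpha> J * avg (\<lambda>t. k * f t) J powr r) n a b (k powr r * l))"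
    using f(6) by simp
  have "admissible a b (k * x) A (\<lambda>t. k * f t) \<alpha>"
    using f assms(2) avg by (simp add: admissible_def)
  with h show "\<exists>f \<alpha> n. admissible a b (k * x) A f \<alpha> \<and>
      v * (b - a) \<le> measure lebesgue (hit (\<lambda>J. \<alpha> J * avg f J powr r) n a b (k powr r * l))"
    by blast
qed

section \<open>The lower bound\<close>

definition best_value :: "real \<Rightarrow> real \<Rightarrow> real \<Rightarrow> real \<Rightarrow> real" where
  "best_value r x A l = Sup {v. attainable r x A l v}"

lemma best_value_upper: "attainable r x A l v \<Longrightarrow> v \<le> best_value r x A l"
  unfolding best_value_def by (rule cSup_upper) (auto intro!: bdd_aboveI[of _ 1] attainable_le_1)

lemma best_value_least:
  assumes "x \<ge> 0" "0 \<le> A" "A \<le> 2" "\<And>v. attainable r x A l v \<Longrightarrow> v \<le> u"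
  shows "best_value r x A l \<le> u"
  unfolding best_value_def using attainable_trivial[OF assms(1-3)] assms(4) by (intro cSup_least) blast+

lemma best_value_nonneg: "x \<ge> 0 \<Longrightarrow> 0 \<le> A \<Longrightarrow> A \<le> 2 \<Longrightarrow> 0 \<le> best_value r x A l"
  using best_value_upper[OF attainable_weaken[OF attainable_trivial[of x A r l], of 0]] by simp

lemma best_value_nonpos: "x \<ge> 0 \<Longrightarrow> 0 \<le> A \<Longrightarrow> A \<le> 2 \<Longrightarrow> l \<le> 0 \<Longrightarrow> 1 \<le> best_value r x A l"
  using best_value_upper[OF attainable_trivial[of x A r l]] by simp

lemma best_value_jump:
  assumes "x \<ge> 0" "0 \<le> B" "B \<le> 1"
  shows "best_value r x B (l - x powr r) \<le> best_value r x (1 + B) l"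
  using assms by (intro best_value_least best_value_upper attainable_jump) auto

lemma best_value_scale:
  assumes "x \<ge> 0" "0 \<le> A" "A \<le> 2" "k > 0"
  shows "best_value r x A l \<le> best_value r (k * x) A (k powr r * l)"
  using assms by (intro best_value_least best_value_upper attainable_scale) auto

lemma best_value_midpoint:
  assumes "x1 \<ge> 0" "A1 \<in> {0..2}" "x2 \<ge> 0" "A2 \<in> {0..2}"
  shows "(best_value r x1 A1 l + best_value r x2 A2 l) / 2 \<le> best_value r ((x1 + x2) / 2) ((A1 + A2) / 2) l"
proof -
  let ?M = "best_value r ((x1 + x2) / 2) ((A1 + A2) / 2) l"
  have "v1 + v2 \<le> 2 * ?M" if "attainable r x1 A1 l v1" "attainable r x2 A2 l v2" for v1 v2
    using best_value_upper[OF attainable_midpoint[OF that assms(2,4)]] by simp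
  then have "best_value r x1 A1 l \<le> 2 * ?M - v2" if "attainable r x2 A2 l v2" for v2
    using assms that by (intro best_value_least) (auto simp: le_diff_eq)
  then have "best_value r x2 A2 l \<le> 2 * ?M - best_value r x1 A1 l"
    using assms by (intro best_value_least) (auto simp: le_diff_eq add.commute)
  then show ?thesis by simp
qed

text \<open>
  Subtract the chord to get \<open>h\<close> with \<open>h 0 = h 1 = 0\<close>, and let
  \<open>M\<close> be its infimum. Every \<open>t\<close> in the left half is the midpoint of
  \<open>0\<close> and \<open>2t\<close>, every \<open>t\<close> in the right half that of
  \<open>1\<close> and \<open>2t - 1\<close>; hence \<open>h \<ge> M / 2\<close>, so \<open>M \<ge>
  M / 2\<close> and \<open>M \<ge> 0\<close>. A lower bound of \<open>g\<close> makes
  \<open>M\<close> finite; continuity is replaced by it, and the endpoints are included.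
\<close>

lemma midpoint_concave_imp_above_chord:
  fixes g :: "real \<Rightarrow> real"
  assumes "\<And>s t. s \<in> {0..1} \<Longrightarrow> t \<in> {0..1} \<Longrightarrow> (g s + g t) / 2 \<le> g ((s + t) / 2)"
    and "\<And>t. t \<in> {0..1} \<Longrightarrow> c \<le> g t" and t: "t \<in> {0..1}"
  shows "(1 - t) * g 0 + t * g 1 \<le> g t"
proof -
  define h where "h t = g t - ((1 - t) * g 0 + t * g 1)" for t
  have mid: "(h s + h t) / 2 \<le> h ((s + t) / 2)" if "s \<in> {0..1}" "t \<in> {0..1}" for s t
    using assms(1)[OF that] by (simp add: h_def field_simps)
  have h01: "h 0 = 0" "h 1 = 0" by (auto simp: h_def)
  define K where "K = c - \<bar>g 0\<bar> - \<bar>g 1\<bar>"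
  have low: "K \<le> h t" if t: "t \<in> {0..1}" for t
  proof -
    have "(1 - t) * g 0 \<le> (1 - t) * \<bar>g 0\<bar>" "(1 - t) * \<bar>g 0\<bar> \<le> 1 * \<bar>g 0\<bar>"
      "t * g 1 \<le> t * \<bar>g 1\<bar>" "t * \<bar>g 1\<bar> \<le> 1 * \<bar>g 1\<bar>"
      using t by (intro mult_left_mono mult_right_mono; simp)+
    then show ?thesis using assms(2)[OF t] by (simp add: h_def K_def)
  qed
  define M where "M = (INF t\<in>{0..1}. h t)"
  have bdd: "bdd_below (h ` {0..1})" using low by (intro bdd_belowI2[of _ K]) auto
  have Mle: "M \<le> h t" if "t \<in> {0..1}" for t unfolding M_def using bdd that by (rule cINF_lower)
  have "M / 2 \<le> h t" if t: "t \<in> {0..1}" for t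
  proof (cases "t \<le> 1 / 2")
    case True
    then show ?thesis using mid[of 0 "2 * t"] Mle[of "2 * t"] t h01 by simp
  next
    case False
    then show ?thesis using mid[of 1 "2 * t - 1"] Mle[of "2 * t - 1"] t h01 by simp
  qed
  then have "M / 2 \<le> M" unfolding M_def by (intro cINF_greatest) auto
  then show ?thesis using Mle[OF t] by (simp add: h_def)
qed

lemma best_value_concave:
  assumes "x1 \<ge> 0" "A1 \<in> {0..2}" "x2 \<ge> 0" "A2 \<in> {0..2}" "0 \<le> t" "t \<le> 1"
  shows "(1 - t) * best_value r x1 A1 l + t * best_value r x2 A2 l
    \<le> best_value r ((1 - t) * x1 + t * x2) ((1 - t) * A1 + t * A2) l"
proof -
  define X where "X t = (1 - t) * x1 + t * x2" for t
  define Y where "Y t = (1 - t) * A1 + t * A2" for t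
  have X: "0 \<le> X t" if "t \<in> {0..1}" for t using assms that by (auto simp: X_def)
  have Y: "Y t \<in> {0..2}" if "t \<in> {0..1}" for t
  proof -
    have "(1 - t) * A1 + t * A2 \<le> 2" using assms that by (intro convex_bound_le) auto
    then show ?thesis using assms that by (auto simp: Y_def)
  qed
  have "(1 - t) * best_value r (X 0) (Y 0) l + t * best_value r (X 1) (Y 1) l \<le> best_value r (X t) (Y t) l"
  proof (rule midpoint_concave_imp_above_chord[where c = 0])
    fix s t :: real assume st: "s \<in> {0..1}" "t \<in> {0..1}"
    have "X ((s + t) / 2) = (X s + X t) / 2" "Y ((s + t) / 2) = (Y s + Y t) / 2"
      by (auto simp: X_def Y_def field_simps)
    then show "(best_value r (X s) (Y s) l + best_value r (X t) (Y t) l) / 2 \<le> best_value r (X ((s + t) / 2)) (Y ((s + t) / 2)) l"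
      using best_value_midpoint[OF X[OF st(1)] Y[OF st(1)] X[OF st(2)] Y[OF st(2)]] by (simp only:)
  next
    show "0 \<le> best_value r (X t) (Y t) l" if "t \<in> {0..1}" for t
      using X[OF that] Y[OF that] by (intro best_value_nonneg) auto
  qed (use assms in auto)
  then show ?thesis by (simp add: X_def Y_def)
qed

text \<open>
  Scaling \<open>w\<close> by \<open>k = (1 + w\<^sup>r)\<close> to the power \<open>-1/r\<close>
  turns level \<open>1\<close> into \<open>k\<^sup>r = 1 - (k w)\<^sup>r\<close>, the level reached
  from \<open>1\<close> by a jump at \<open>k w = \<psi>(2 w)\<close>.
\<close>

lemma best_value_psi:
  assumes "r > 0" "w \<ge> 0" "0 \<le> B" "B \<le> 1"
  shows "best_value r w B 1 \<le> best_value r (psi r (2 * w)) (1 + B) 1"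
proof -
  define S where "S = 1 + w powr r"
  have S: "S > 0" by (simp add: S_def add_pos_nonneg)
  define k where "k = S powr (- 1 / r)"
  have k: "k > 0" using S by (simp add: k_def)
  have kr: "k powr r = 1 / S" using S assms(1) powr_minus_divide[of S 1] by (simp add: k_def powr_powr)
  have "2 powr r + (2 * w) powr r = 2 powr r * S" using assms by (simp add: S_def powr_mult algebra_simps)
  then have "(2 powr r + (2 * w) powr r) powr (1 / r) = 2 * S powr (1 / r)"
    using assms(1) S by (simp add: powr_mult powr_powr)
  then have psi: "psi r (2 * w) = k * w"
    by (simp add: psi_def k_def powr_minus_divide)
  have "k powr r * 1 = 1 - (k * w) powr r"
  proof -
    have "(k * w) powr r = 1 / S * w powr r" using k assms by (simp add: powr_mult kr)
    also have "w powr r = S - 1" by (simp add: S_def)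
    finally show ?thesis using S by (simp add: kr field_simps)
  qed
  then have "best_value r w B 1 \<le> best_value r (k * w) B (1 - (k * w) powr r)"
    using best_value_scale[of w B k r 1] assms k by simp
  also have "\<dots> \<le> best_value r (k * w) (1 + B) 1" using assms k by (intro best_value_jump) auto
  finally show ?thesis by (simp add: psi)
qed

text \<open>
  A single jump wins as soon as the average is at least \<open>1\<close>.
\<close>

lemma best_value_eq_1:
  assumes "r > 0" "1 \<le> w" "1 \<le> A" "A \<le> 2"
  shows "1 \<le> best_value r w A 1"
proof -
  have "1 - w powr r \<le> 0" using assms by (simp add: ge_one_powr_ge_zero)
  then have "1 \<le> best_value r w (A - 1) (1 - w powr r)" using assms by (intro best_value_nonpos) auto
  also have "\<dots> \<le> best_value r w (1 + (A - 1)) 1" using assms by (intro best_value_jump) auto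
  finally show ?thesis by simp
qed

lemma best_value_shrink:
  assumes "w \<ge> 0" "A \<in> {0..2}" "0 \<le> s" "s \<le> 1"
  shows "s * best_value r w A l \<le> best_value r (s * w) (s * A) l"
proof -
  have "(1 - s) * best_value r 0 0 l + s * best_value r w A l \<le> best_value r (s * w) (s * A) l"
    using best_value_concave[of 0 0 w A s r l] assms by simp
  moreover have "0 \<le> (1 - s) * best_value r 0 0 l" using assms by (intro mult_nonneg_nonneg best_value_nonneg) auto
  ultimately show ?thesis by linarith
qed

text \<open>
  The optimal strategy at a node with \<open>A = 2\<close> is a jump followed by concentrating
  everything on one half: it leads from one node to the preceding one and costs a factor
  \<open>2\<close>.
\<close>

lemma best_value_node:
  assumes "r > 0"
  shows "2 / 2 ^ Suc n \<le> best_value r (node r (Suc n)) 2 1"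
proof (induction n)
  case 0
  have "1 \<le> best_value r 1 1 1" using assms by (intro best_value_eq_1) auto
  also have "\<dots> \<le> best_value r (psi r (2 * 1)) (1 + 1) 1" using assms by (intro best_value_psi) auto
  finally show ?case using node_Suc[OF assms, of 0] by simp
next
  case (Suc n)
  have pos: "0 \<le> node r (Suc n)" using node_pos[OF assms] less_imp_le by blast
  have "2 / 2 ^ Suc (Suc n) = 1 / 2 * (2 / 2 ^ Suc n :: real)" by simp
  also have "\<dots> \<le> 1 / 2 * best_value r (node r (Suc n)) 2 1" using Suc by (intro mult_left_mono) auto
  also have "\<dots> \<le> best_value r (1 / 2 * node r (Suc n)) (1 / 2 * 2) 1"
    using pos by (intro best_value_shrink) auto
  also have "\<dots> \<le> best_value r (psi r (2 * (1 / 2 * node r (Suc n)))) (1 + 1) 1"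
    using best_value_psi[OF assms, of "1 / 2 * node r (Suc n)" 1] pos by simp
  also have "\<dots> = best_value r (node r (Suc (Suc n))) 2 1" by (simp add: node_Suc[OF assms] del: node.simps)
  finally show ?case .
qed

text \<open>
  For \<open>A < 1\<close> the point \<open>(w, A)\<close> is a convex combination of \<open>(1,
  1)\<close>, with weight \<open>A\<close> and value \<open>1\<close>, and a point with \<open>A =
  0\<close>.
\<close>

lemma envelope_le_best_value_diagonal:
  assumes "r > 0" "0 \<le> A" "A \<le> 2" "A \<le> w"
  shows "envelope r w A \<le> best_value r w A 1"
proof (cases "1 \<le> A")
  case True
  then show ?thesis using best_value_eq_1[of r w A] assms envelope_eq_min[of r A w] by simp
next
  case False
  define y where "y = (w - A) / (1 - A)"
  have y: "y \<ge> 0" "(1 - A) * y = w - A" using False assms by (auto simp: y_def)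
  have "A * 1 \<le> A * best_value r 1 1 1" using assms best_value_eq_1[of r 1 1] by (intro mult_left_mono) auto
  also have "\<dots> \<le> (1 - A) * best_value r y 0 1 + A * best_value r 1 1 1"
    using False y best_value_nonneg[of y 0 r 1] by simp
  also have "\<dots> \<le> best_value r w A 1"
    using best_value_concave[of y 0 1 1 A r 1] y False assms by simp
  finally show ?thesis using False assms envelope_eq_min[of r A w] by simp
qed

text \<open>
  The sector over a segment is a cone with apex \<open>(0, 0)\<close>; the chord between its two
  nodes at \<open>A = 2\<close> bounds the value from below, and contraction to the apex transports
  this to smaller \<open>A\<close>.
\<close>

lemma plane_le_best_value_sector:
  assumes "r > 0" "0 < A" "A \<le> 2"
    and "node r (Suc (Suc j)) * A \<le> 2 * w" "2 * w \<le> node r (Suc j) * A"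
  shows "plane r (Suc j) w A \<le> best_value r w A 1"
proof -
  define k where "k = Suc j"
  define y where "y = 2 * w / A"
  have k1: "node r (Suc k) \<le> y" and k2: "y \<le> node r k"
    using assms(2,4,5) by (auto simp: y_def k_def field_simps simp del: node.simps)
  have y: "0 \<le> y" using k1 node_pos[OF assms(1), of "Suc k"] by linarith
  define t where "t = (y - node r (Suc k)) / (node r k - node r (Suc k))"
  have d: "node r k - node r (Suc k) > 0" using node_Suc_less[OF assms(1), of k] by simp
  have t: "0 \<le> t" "t \<le> 1" using d k1 k2 by (auto simp: t_def simp del: node.simps)
  have ty: "t * (node r k - node r (Suc k)) = y - node r (Suc k)"
    using d by (simp add: t_def del: node.simps)
  then have yt: "y = (1 - t) * node r (Suc k) + t * node r k"
    by (simp add: algebra_simps del: node.simps)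
  have "slope r k * (y - node r (Suc k)) = t / 2 ^ k"
    unfolding ty[symmetric] slope_def using d by (simp del: node.simps)
  then have "chord r k y = (1 - t) * (2 / 2 ^ Suc k) + t * (2 / 2 ^ k)"
    by (simp add: chord_def left_diff_distrib diff_divide_distrib del: node.simps)
  also have "\<dots> \<le> (1 - t) * best_value r (node r (Suc k)) 2 1 + t * best_value r (node r k) 2 1"
    using t best_value_node[OF assms(1), of k] best_value_node[OF assms(1), of j, folded k_def]
    by (intro add_mono mult_left_mono) simp_all
  also have "\<dots> \<le> best_value r y 2 1"
    using best_value_concave[of "node r (Suc k)" 2 "node r k" 2 t r 1] t
      less_imp_le[OF node_pos[OF assms(1)]]
    unfolding yt by (simp del: node.simps)
  finally have "A / 2 * chord r k y \<le> A / 2 * best_value r y 2 1"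
    using assms(2) by (intro mult_left_mono) auto
  also have "\<dots> \<le> best_value r (A / 2 * y) (A / 2 * 2) 1"
    using y assms by (intro best_value_shrink) auto
  also have "\<dots> = best_value r w A 1" using assms(2) by (simp add: y_def)
  finally show ?thesis using assms(2) by (simp add: plane_eq_chord y_def k_def)
qed

text \<open>
  The plane with index \<open>0\<close> interpolates the values \<open>0, 1, 1\<close> at \<open>(0,
  0)\<close>, \<open>(1, 1)\<close> and \<open>(\<omega>\<^sub>0, 2)\<close>. If its value \<open>p
  + q\<close> is at most \<open>1\<close>, the point lies in this triangle and \<open>p\<close>,
  \<open>q\<close> are its barycentric coordinates. Otherwise it lies on a segment from
  \<open>(\<omega>\<^sub>0, 2)\<close> to a point \<open>(1, C)\<close> with \<open>C \<ge>
  1\<close>, both of value \<open>1\<close>, or it has \<open>w \<ge> 1\<close>.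
\<close>

lemma plane_0_le_best_value_triangle:
  assumes "r > 0" "0 < A" "A \<le> 2" "w < A" "node r 1 * A \<le> 2 * w"
  shows "min 1 (plane r 0 w A) \<le> best_value r w A 1"
proof -
  define o0 where "o0 = node r 1"
  have o0: "0 < o0" "o0 < 1" using omega_0_bounds[OF assms(1)] by (auto simp: o0_def)
  have go: "1 \<le> best_value r o0 2 1" using best_value_node[OF assms(1), of 0] by (simp add: o0_def)
  have g1: "1 \<le> best_value r 1 C 1" if "1 \<le> C" "C \<le> 2" for C
    using assms(1) that by (intro best_value_eq_1) auto
  define q where "q = (A - w) / (2 - o0)"
  define p where "p = A - 2 * q"
  have q: "0 < q" "q * (2 - o0) = A - w" using assms(4) o0 by (auto simp: q_def)
  have p: "0 \<le> p"
  proof -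
    have "(2 * q) * (2 - o0) \<le> A * (2 - o0)"
      using assms(5)[folded o0_def] q(2) by (simp add: algebra_simps)
    then have "2 * q \<le> A" using o0 by simp
    then show ?thesis by (simp add: p_def)
  qed
  have wp: "w = p + q * o0" using q(2) by (simp add: p_def algebra_simps)
  have Ap: "A = p + 2 * q" by (simp add: p_def)
  have pq: "(p + q) * (2 - o0) = w + (1 - o0) * A"
    unfolding wp Ap by (simp add: algebra_simps)
  have plane: "plane r 0 w A = p + q"
    unfolding plane_0[OF assms(1)] using pq o0 by (simp add: o0_def divide_eq_eq)
  show ?thesis
  proof (cases "p + q \<le> 1")
    case True
    \<comment> \<open>\<open>(z, C)\<close> is the point where the ray from the origin through \<open>(w, A)\<close> meets the edge of value \<open>1\<close>.\<close>
    define s where "s = p + q"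
    have s: "0 < s" "s \<le> 1" using p q True by (auto simp: s_def)
    define t where "t = q / s"
    have t: "0 \<le> t" "t \<le> 1" "s * t = q" using p q s by (auto simp: t_def s_def)
    define z where "z = (1 - t) * 1 + t * o0"
    define C where "C = (1 - t) * 1 + t * 2"
    have z: "z \<ge> 0" "C \<in> {0..2}" using t o0 by (auto simp: z_def C_def)
    have "(1 - t) * 1 + t * 1 \<le> (1 - t) * best_value r 1 1 1 + t * best_value r o0 2 1"
      using t go g1[of 1] by (intro add_mono mult_left_mono) auto
    also have "\<dots> \<le> best_value r z C 1"
      unfolding z_def C_def using t o0 by (intro best_value_concave) auto
    finally have "s * 1 \<le> s * best_value r z C 1" using s by (intro mult_left_mono) auto
    also have "\<dots> \<le> best_value r (s * z) (s * C) 1" using s z by (intro best_value_shrink) auto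
    also have "s * z = w"
    proof -
      have "s * z = s - s * t + s * t * o0" by (simp add: z_def algebra_simps)
      then show ?thesis by (simp add: t(3) wp) (simp add: s_def)
    qed
    also have "s * C = A"
    proof -
      have "s * C = s + s * t" by (simp add: C_def algebra_simps)
      then show ?thesis by (simp add: t(3) Ap) (simp add: s_def)
    qed
    finally show ?thesis unfolding plane by (simp add: s_def)
  next
    case above: False
    show ?thesis
    proof (cases "1 \<le> w")
      case True
      then show ?thesis using best_value_eq_1[of r w A] assms by simp
    next
      case False
      \<comment> \<open>The weight \<open>m\<close> of \<open>(o0, 2)\<close> is forced by the abscissa \<open>w\<close>, and then \<open>C\<close> by the ordinate \<open>A\<close>.\<close>
      define m where "m = (1 - w) / (1 - o0)"
      have m0: "0 < m" "m * (1 - o0) = 1 - w" using False o0 by (auto simp: m_def)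
      have mA: "1 + m < A"
      proof -
        have "1 * (2 - o0) < (p + q) * (2 - o0)"
          using above o0 by (intro mult_strict_right_mono) auto
        then have "m * (1 - o0) < (A - 1) * (1 - o0)"
          unfolding m0(2) pq by (simp add: algebra_simps)
        then show ?thesis using o0 by simp
      qed
      then have m1: "m < 1" using assms by simp
      define C where "C = (A - m * 2) / (1 - m)"
      have C: "(1 - m) * C = A - m * 2" using m1 by (simp add: C_def)
      have C12: "1 \<le> C" "C \<le> 2" using m1 mA assms by (auto simp: C_def field_simps)
      have "(1 - m) * 1 + m * 1 \<le> (1 - m) * best_value r 1 C 1 + m * best_value r o0 2 1"
        using m0 m1 go g1[OF C12] by (intro add_mono mult_left_mono) auto
      also have "\<dots> \<le> best_value r ((1 - m) * 1 + m * o0) ((1 - m) * C + m * 2) 1"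
        using m0 m1 C12 o0 by (intro best_value_concave) auto
      also have "(1 - m) * 1 + m * o0 = w" using m0(2) by (simp add: algebra_simps)
      also have "(1 - m) * C + m * 2 = A" using C by simp
      finally show ?thesis by simp
    qed
  qed
qed

lemma envelope_le_best_value:
  assumes "r > 0" "w \<ge> 0" "0 \<le> A" "A \<le> 2"
  shows "envelope r w A \<le> best_value r w A 1"
proof -
  consider "A \<le> w" | "w < A" "w = 0" | "w < A" "0 < w" using assms(2) by linarith
  then show ?thesis
  proof cases
    case 1
    then show ?thesis using assms by (intro envelope_le_best_value_diagonal) auto
  next
    case 2
    then show ?thesis using envelope_0[of r A] best_value_nonneg assms by simp
  next
    case 3
    define y where "y = 2 * w / A"
    have y: "0 < y" "y < 2" using 3 by (auto simp: y_def divide_less_eq)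
    obtain k where k: "node r (Suc k) \<le> y" "y < node r k \<or> k = 0"
      using node_segment_exists[OF assms(1) y(1)] y(2) by auto
    have sector: "node r (Suc k) * A \<le> 2 * w" "2 * w \<le> node r k * A"
      using k y(2) 3 by (auto simp: y_def field_simps simp del: node.simps(2))
    have M: "envelope r w A = min 1 (plane r k w A)"
      using sector 3 assms by (intro envelope_eq_min_plane) auto
    show ?thesis
    proof (cases k)
      case 0
      then show ?thesis using M sector(1) plane_0_le_best_value_triangle[of r A w] 3 assms by simp
    next
      case (Suc j)
      then show ?thesis using M sector plane_le_best_value_sector[of r A j w] 3 assms by simp
    qed
  qed
qed

theorem theorem1:
  fixes a b r x A lam :: real
  assumes "a < b" and "r > 0" and "x \<ge> 0" and "0 \<le> A" and "A \<le> 2" and "lam > 0"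
  shows "bellman {a..<b} r x A lam = explicit_M r (x * lam powr (- 1 / r)) A"
proof -
  \<comment> \<open>Dividing \<open>f\<close> by \<open>k\<close> normalises the level to \<open>1\<close>.\<close>
  define k where "k = lam powr (1 / r)"
  have k: "k > 0" "k powr r = lam" using assms(2,6) by (auto simp: k_def powr_powr)
  have w: "x * lam powr (- 1 / r) = x / k" by (simp add: k_def powr_minus_divide)
  have potential: "potential r x A lam = envelope r (x / k) A" using assms(6) by (simp add: potential_def k_def)
  define E where "E f \<alpha> = {t \<in> {a..<b}. ennreal lam \<le> tower (\<lambda>J. \<alpha> J * avg f J powr r) {a..<b} t}"
    for f \<alpha>
  define S where "S = {measure lebesgue (E f \<alpha>) / (b - a) | f \<alpha>. admissible a b x A f \<alpha>}"
  have bellman: "bellman {a..<b} r x A lam = Sup S"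
    unfolding bellman_def S_def E_def admissible_def dyadic_operator_def tower_def
    using assms(1) by simp
  have upper: "s \<le> envelope r (x / k) A" if "s \<in> S" for s
  proof -
    obtain f \<alpha> where adm: "admissible a b x A f \<alpha>" and s: "s = measure lebesgue (E f \<alpha>) / (b - a)"
      using \<open>s \<in> S\<close> unfolding S_def by blast
    note f = admissibleD[OF adm]
    have "carleson_real \<alpha> {a..<b} = A" using f(5) assms(4) by (simp add: carleson_real_def)
    then have "measure lebesgue (hit (\<lambda>J. \<alpha> J * avg f J powr r) n a b lam) \<le> (b - a) * envelope r (x / k) A" for n
      using measure_hit_le_potential[OF assms(2,1) f(1,2,4), of n lam] f(3) potential by simp
    then have "measure lebesgue (E f \<alpha>) \<le> (b - a) * envelope r (x / k) A"
      unfolding E_def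
      by (intro LIMSEQ_le_const2[OF measure_tower_level_set(1)[OF assms(1) f(4)]]) auto
    then show ?thesis using assms(1) s by (simp add: divide_le_eq mult.commute)
  qed
  have "envelope r (x / k) A \<le> best_value r (x / k) A 1"
    using assms k by (intro envelope_le_best_value) auto
  also have "\<dots> \<le> best_value r x A lam"
    using best_value_scale[of "x / k" A k r 1] assms k by simp
  also have "\<dots> \<le> Sup S"
  proof (rule best_value_least)
    fix v assume "attainable r x A lam v"
    then obtain f \<alpha> n where adm: "admissible a b x A f \<alpha>"
      and h: "v * (b - a) \<le> measure lebesgue (hit (\<lambda>J. \<alpha> J * avg f J powr r) n a b lam)"
      using attainableE[OF _ assms(1)] by blast
    note h
    also have "measure lebesgue (hit (\<lambda>J. \<alpha> J * avg f J powr r) n a b lam) \<le> measure lebesgue (E f \<alpha>)"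
      unfolding E_def by (rule measure_tower_level_set(2)[OF assms(1) admissibleD(4)[OF adm]]) simp
    finally have "v \<le> measure lebesgue (E f \<alpha>) / (b - a)" using assms(1) by (simp add: le_divide_eq)
    also have "\<dots> \<le> Sup S"
    proof (rule cSup_upper)
      show "bdd_above S" using upper by (rule bdd_aboveI)
      show "measure lebesgue (E f \<alpha>) / (b - a) \<in> S" unfolding S_def using adm by blast
    qed
    finally show "v \<le> Sup S" .
  qed (use assms in auto)
  finally have lower: "envelope r (x / k) A \<le> Sup S" .
  obtain f \<alpha> where "admissible a b x A f \<alpha>"
    using attainableE[OF attainable_trivial[OF assms(3-5), of r lam] assms(1)] .
  then have "S \<noteq> {}" unfolding S_def by blast
  then have "Sup S \<le> envelope r (x / k) A" using upper by (rule cSup_least)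
  with lower have "Sup S = envelope r (x / k) A" by simp
  then show ?thesis
    using explicit_M_eq_envelope[of r "x / k" A] assms k unfolding bellman w by simp
qed

end
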